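(* Let $K$ be a field of characteristic two and let $G$ be a $2$-group of maximal class. Then the wreath product $C_2 \wr G'$ of a cyclic group $C_2$ of order two with the commutator subgroup $G'$ of $G$ is involved in the group $U(KG)$ of normalized units of the group algebra $KG$; that is, there exist a subgroup $F \le U(KG)$ and a normal subgroup $N \trianglelefteq F$ such that $F/N \cong C_2 \wr G'$.
   Context: The $2$-groups of maximal class considered are, for $n\ge 3$, the dihedral, semidihedral and generalized quaternion groups of order $2^n$: $D_n=\langle a,b \mid a^{2^{n-1}}=1,\ b^2=1,\ b^{-1}ab=a^{-1}\rangle$; $S_n=\langle a,b \mid a^{2^{n-1}}=1,\ b^2=1,\ b^{-1}ab=a^{-1+2^{n-2}}\rangle$ (with $S_3$ identified with $D_3$, so effectively $n\ge4$); $Q_n=\langle a,b \mid a^{2^{n-1}}=1,\ b^2=a^{2^{n-2}},\ b^{-1}ab=a^{-1}\rangle$. The group of normalized units $U(KG)$ consists of all elements $1+x$ with $x$ in the augmentation ideal $\Delta_K(G)$ of $KG$, i.e. the units of augmentation $1$. The wreath product $C_2\wr H$ of $C_2$ with a finite group $H$ is the regular (standard) one: the semidirect product of the direct power $C_2^{|H|}$, with coordinates indexed by $H$, with $H$ acting by the regular permutation of the coordinates. A group $M$ is "involved" in a group $U$ if $U$ has a section isomorphic to $M$ (a factor group of a subgroup of $U$). *)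

theory Defs
  imports "HOL-Algebra.Algebra"
begin

text \<open>
  Each of the three presentations defines a group of order \<open>2 ^ n\<close>. Hence a group is given by the
  presentation iff it has order \<open>2 ^ n\<close> and is generated by two elements satisfying the relations.
\<close>

definition dihedral_2_group :: "nat \<Rightarrow> ('a, 'b) monoid_scheme \<Rightarrow> bool" where
  "dihedral_2_group n G \<longleftrightarrow> group G \<and> order G = 2 ^ n \<and>
     (\<exists>a\<in>carrier G. \<exists>b\<in>carrier G. generate G {a, b} = carrier G \<and>
        a [^]\<^bsub>G\<^esub> (2 ^ (n - 1) :: nat) = \<one>\<^bsub>G\<^esub> \<and>
        b [^]\<^bsub>G\<^esub> (2 :: nat) = \<one>\<^bsub>G\<^esub> \<and>
        inv\<^bsub>G\<^esub> b \<otimes>\<^bsub>G\<^esub> a \<otimes>\<^bsub>G\<^esub> b = inv\<^bsub>G\<^esub> a)"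

definition semidihedral_2_group :: "nat \<Rightarrow> ('a, 'b) monoid_scheme \<Rightarrow> bool" where
  "semidihedral_2_group n G \<longleftrightarrow> group G \<and> order G = 2 ^ n \<and>
     (\<exists>a\<in>carrier G. \<exists>b\<in>carrier G. generate G {a, b} = carrier G \<and>
        a [^]\<^bsub>G\<^esub> (2 ^ (n - 1) :: nat) = \<one>\<^bsub>G\<^esub> \<and>
        b [^]\<^bsub>G\<^esub> (2 :: nat) = \<one>\<^bsub>G\<^esub> \<and>
        inv\<^bsub>G\<^esub> b \<otimes>\<^bsub>G\<^esub> a \<otimes>\<^bsub>G\<^esub> b = a [^]\<^bsub>G\<^esub> (- 1 + 2 ^ (n - 2) :: int))"

definition generalized_quaternion_2_group :: "nat \<Rightarrow> ('a, 'b) monoid_scheme \<Rightarrow> bool" where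
  "generalized_quaternion_2_group n G \<longleftrightarrow> group G \<and> order G = 2 ^ n \<and>
     (\<exists>a\<in>carrier G. \<exists>b\<in>carrier G. generate G {a, b} = carrier G \<and>
        a [^]\<^bsub>G\<^esub> (2 ^ (n - 1) :: nat) = \<one>\<^bsub>G\<^esub> \<and>
        b [^]\<^bsub>G\<^esub> (2 :: nat) = a [^]\<^bsub>G\<^esub> (2 ^ (n - 2) :: nat) \<and>
        inv\<^bsub>G\<^esub> b \<otimes>\<^bsub>G\<^esub> a \<otimes>\<^bsub>G\<^esub> b = inv\<^bsub>G\<^esub> a)"

text \<open>
  For \<open>n = 3\<close> the semidihedral relations would give an abelian group; by convention the
  semidihedral group of order 8 is the dihedral one, so that family starts at \<open>n = 4\<close>.
\<close>

definition maximal_class_2_group :: "('a, 'b) monoid_scheme \<Rightarrow> bool" where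
  "maximal_class_2_group G \<longleftrightarrow>
     (\<exists>n\<ge>3. dihedral_2_group n G \<or> generalized_quaternion_2_group n G) \<or>
     (\<exists>n\<ge>4. semidihedral_2_group n G)"

definition ring_characteristic :: "('a, 'b) ring_scheme \<Rightarrow> nat" where
  "ring_characteristic R =
     (if \<exists>m::nat. m > 0 \<and> add_pow R m \<one>\<^bsub>R\<^esub> = \<zero>\<^bsub>R\<^esub>
      then LEAST m::nat. m > 0 \<and> add_pow R m \<one>\<^bsub>R\<^esub> = \<zero>\<^bsub>R\<^esub>
      else 0)"

text \<open>
  The group algebra of a finite group \<open>G\<close>: the formal sum of all \<open>f x \<cdot> x\<close> is represented by its
  coefficient function \<open>f\<close>, and multiplication is convolution. (For infinite \<open>G\<close> one would have to
  add finiteness of supports.)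
\<close>

definition group_algebra ::
    "('k, 'm) ring_scheme \<Rightarrow> ('g, 'n) monoid_scheme \<Rightarrow> ('g \<Rightarrow> 'k) ring" where
  "group_algebra K G =
     \<lparr>carrier = carrier G \<rightarrow>\<^sub>E carrier K,
      monoid.mult = (\<lambda>f g. \<lambda>x\<in>carrier G.
                \<Oplus>\<^bsub>K\<^esub>y\<in>carrier G. f y \<otimes>\<^bsub>K\<^esub> g (inv\<^bsub>G\<^esub> y \<otimes>\<^bsub>G\<^esub> x)),
      monoid.one = (\<lambda>x\<in>carrier G. if x = \<one>\<^bsub>G\<^esub> then \<one>\<^bsub>K\<^esub> else \<zero>\<^bsub>K\<^esub>),
      ring.zero = (\<lambda>x\<in>carrier G. \<zero>\<^bsub>K\<^esub>),
      ring.add = (\<lambda>f g. \<lambda>x\<in>carrier G. f x \<oplus>\<^bsub>K\<^esub> g x)\<rparr>"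

definition augmentation ::
    "('k, 'm) ring_scheme \<Rightarrow> ('g, 'n) monoid_scheme \<Rightarrow> ('g \<Rightarrow> 'k) \<Rightarrow> 'k" where
  "augmentation K G f = (\<Oplus>\<^bsub>K\<^esub>x\<in>carrier G. f x)"

text \<open>
  The units of augmentation \<open>1\<close>. If \<open>G\<close> is a finite \<open>p\<close>-group and \<open>K\<close> has characteristic \<open>p\<close>, the
  kernel of the augmentation is nilpotent, so every element of augmentation \<open>1\<close>, that is,
  every \<open>1 + x\<close> with \<open>x\<close> in the augmentation ideal, is such a unit.
\<close>

definition normalized_units ::
    "('k, 'm) ring_scheme \<Rightarrow> ('g, 'n) monoid_scheme \<Rightarrow> ('g \<Rightarrow> 'k) monoid" where
  "normalized_units K G =
     (units_of (group_algebra K G))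
       \<lparr>carrier := {u \<in> Units (group_algebra K G). augmentation K G u = \<one>\<^bsub>K\<^esub>}\<rparr>"

definition semidirect_product ::
    "('a, 'm) monoid_scheme \<Rightarrow> ('h, 'n) monoid_scheme \<Rightarrow> ('h \<Rightarrow> 'a \<Rightarrow> 'a) \<Rightarrow> ('a \<times> 'h) monoid" where
  "semidirect_product A H \<phi> =
     \<lparr>carrier = carrier A \<times> carrier H,
      monoid.mult = (\<lambda>(a, h) (b, k). (a \<otimes>\<^bsub>A\<^esub> \<phi> h b, h \<otimes>\<^bsub>H\<^esub> k)),
      one = (\<one>\<^bsub>A\<^esub>, \<one>\<^bsub>H\<^esub>)\<rparr>"

text \<open>
  The regular wreath product \<open>A \<wr> H\<close> for finite \<open>H\<close>: an element \<open>h\<close> moves the coordinate at \<open>x\<close> to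
  position \<open>h x\<close>. (For infinite \<open>H\<close> this is the unrestricted wreath product.)
\<close>

definition regular_wreath_product ::
    "('a, 'm) monoid_scheme \<Rightarrow> ('h, 'n) monoid_scheme \<Rightarrow> (('h \<Rightarrow> 'a) \<times> 'h) monoid" where
  "regular_wreath_product A H =
     semidirect_product (product_group (carrier H) (\<lambda>_. A)) H
       (\<lambda>h f. \<lambda>x\<in>carrier H. f (inv\<^bsub>H\<^esub> h \<otimes>\<^bsub>H\<^esub> x))"

definition involved_in :: "('a, 'm) monoid_scheme \<Rightarrow> ('u, 'n) monoid_scheme \<Rightarrow> bool" where
  "involved_in M U \<longleftrightarrow>
     (\<exists>F N. subgroup F U \<and> N \<lhd> U\<lparr>carrier := F\<rparr> \<and> U\<lparr>carrier := F\<rparr> Mod N \<cong> M)"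

end

theory Submission
  imports Defs "HOL-Number_Theory.Cong"
begin

text \<open>
  Let \<open>m = 2 ^ k\<close> be the order of the commutator subgroup \<open>\<langle>a\<^sup>2\<rangle>\<close>, and put \<open>s = a + b a b\<^sup>-\<^sup>1\<close>. Then
  \<open>s\<close> is central in the group algebra, \<open>s ^ m = 0\<close>, and \<open>s ^ (m - 1)\<close> is the sum of the odd powers
  of \<open>a\<close>. Put \<open>c = 1 + \<theta> b\<close>, where \<open>\<theta> = 1\<close> if \<open>b\<^sup>2 = 1\<close>, and where in the quaternion case \<open>\<theta>\<close> is a
  polynomial in \<open>s\<close> with \<open>\<theta>\<^sup>2 = b\<^sup>2 + s ^ (m - 1) a\<close>. In both cases \<open>s c\<^sup>2 = 0\<close> and
  \<open>c a c = s c + c\<^sup>2 b a b\<^sup>-\<^sup>1\<close>, so that the unit \<open>h = 1 + c a\<close> satisfies \<open>h c = (1 + s) c h\<close>. Thus \<open>h\<close>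
  permutes the units \<open>1 + (1 + s) ^ i c\<close> cyclically. Modulo the abelian group \<open>N\<close> of order at most four
  generated by \<open>1 + c\<^sup>2\<close> and \<open>1 + s ^ (m - 1) c a\<close>, which commutes with all of them and contains
  \<open>h ^ m\<close>, these units generate an elementary abelian group of rank \<open>m\<close>: the multiplication by
  \<open>1 + s\<close> on the span of the \<open>s ^ i c\<close> is a single unipotent block of size \<open>m\<close>, as
  \<open>s ^ (m - 1) c\<close> is not in \<open>N - 1\<close>. Together with \<open>h\<close> they generate the wreath product modulo \<open>N\<close>.
\<close>

section \<open>Rings of characteristic two\<close>

text \<open>The requirement \<open>s c^2 = 0\<close> shapes the construction. With
  \<open>d = b a b^-1\<close> and \<open>s = a + d\<close> it gives \<open>c^2 d = c^2 a\<close>,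
  and this turns \<open>c a c = s c + c^2 d\<close> into \<open>h c = (1 + s) c h\<close>. The
  choice \<open>c = 1 + b\<close> meets it when \<open>b^2 = 1\<close>, as then
  \<open>c^2 = 0\<close>. It fails for quaternion groups of order at least 16, where
  \<open>s (1 + a^m)\<close> is a sum of four distinct powers of \<open>a\<close>. Rescaling
  \<open>b\<close> to \<open>\<theta> b\<close> calls for a square root of \<open>b^2 = a^m\<close>
  that commutes with \<open>b\<close>; the obvious root \<open>a^(m/2)\<close> does not commute with
  \<open>b\<close>, so a root up to the error \<open>s^(m-1) a\<close> is taken, which
  \<open>s\<close> kills. Two identities then hold only approximately: \<open>c^2\<close> may be
  nonzero, and \<open>h^m\<close> is \<open>1 + s^(m-1) c a\<close>, possibly with
  \<open>c^2\<close> added. Both errors are annihilated by \<open>s\<close> and are absorbed by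
  \<open>N\<close>, which is why a section appears and not a subgroup. Independence modulo
  \<open>N\<close> needs one test only. A nonzero polynomial in \<open>s\<close> over the prime
  field is a power of \<open>s\<close> times a unit, so a suitable power of \<open>s\<close> moves
  any relation to \<open>s^(m-1) c\<close>.\<close>

locale char2_ring = ring +
  assumes char2: "\<one> \<oplus> \<one> = \<zero>"
begin

lemma add_self [simp]: "x \<in> carrier R \<Longrightarrow> x \<oplus> x = \<zero>"
  by (metis char2 l_distr l_null l_one one_closed)

lemma add_self_left [simp]: "x \<in> carrier R \<Longrightarrow> y \<in> carrier R \<Longrightarrow> x \<oplus> (x \<oplus> y) = y"
  by (metis a_assoc add_self l_zero)

lemma add_eq_zero_iff: "x \<in> carrier R \<Longrightarrow> y \<in> carrier R \<Longrightarrow> x \<oplus> y = \<zero> \<longleftrightarrow> x = y"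
  by (metis add_self_left add_self r_zero)

lemma square_add:
  assumes "x \<in> carrier R" "y \<in> carrier R" "x \<otimes> y = y \<otimes> x"
  shows "(x \<oplus> y) \<otimes> (x \<oplus> y) = x \<otimes> x \<oplus> y \<otimes> y"
  using assms by (simp add: l_distr r_distr a_ac)

lemma nat_pow_double: "x \<in> carrier R \<Longrightarrow> x [^] (2 * n :: nat) = x [^] n \<otimes> x [^] n"
  by (simp add: mult_2 nat_pow_mult)

lemma frobenius_add:
  assumes "x \<in> carrier R" "y \<in> carrier R" "x \<otimes> y = y \<otimes> x"
  shows "(x \<oplus> y) [^] (2 ^ k :: nat) = x [^] (2 ^ k :: nat) \<oplus> y [^] (2 ^ k :: nat)"
proof (induction k)
  case (Suc k)
  have "x [^] (2 ^ k :: nat) \<otimes> y [^] (2 ^ k :: nat) = y [^] (2 ^ k :: nat) \<otimes> x [^] (2 ^ k :: nat)"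
    using assms by (metis group_commutes_pow nat_pow_closed)
  then show ?case
    using assms Suc by (simp add: nat_pow_double square_add)
qed (use assms in simp)

lemma finsum_sym_diff:
  assumes "finite S" "finite T" "f \<in> S \<union> T \<rightarrow> carrier R"
  shows "finsum R f (sym_diff S T) = finsum R f S \<oplus> finsum R f T"
proof -
  have c: "f \<in> (S - T) \<rightarrow> carrier R" "f \<in> (T - S) \<rightarrow> carrier R" "f \<in> (S \<inter> T) \<rightarrow> carrier R"
    using assms by auto
  have "finsum R f ((S - T) \<union> (S \<inter> T)) = finsum R f (S - T) \<oplus> finsum R f (S \<inter> T)"
    using assms c by (intro finsum_Un_disjoint) auto
  moreover have "finsum R f ((T - S) \<union> (S \<inter> T)) = finsum R f (T - S) \<oplus> finsum R f (S \<inter> T)"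
    using assms c by (intro finsum_Un_disjoint) auto
  moreover have "finsum R f (sym_diff S T) = finsum R f (S - T) \<oplus> finsum R f (T - S)"
    using assms c by (intro finsum_Un_disjoint) auto
  moreover have "(S - T) \<union> (S \<inter> T) = S" "(T - S) \<union> (S \<inter> T) = T" by auto
  ultimately show ?thesis using c by (simp add: a_ac)
qed

lemma Units_if_pow_eq_one:
  assumes "x \<in> carrier R" "x [^] n = \<one>" "n > (0::nat)"
  shows "x \<in> Units R"
proof -
  obtain j where "n = Suc j" using assms(3) by (cases n) auto
  then have "x [^] j \<otimes> x = \<one>" "x \<otimes> x [^] j = \<one>"
    using assms nat_pow_Suc2[of x j] by auto
  then show ?thesis using assms(1) by (auto simp: Units_def)
qed

lemma one_plus_nilpotent_Units:
  assumes "x \<in> carrier R" "x [^] (2 ^ k :: nat) = \<zero>"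
  shows "\<one> \<oplus> x \<in> Units R"
proof -
  have "(\<one> \<oplus> x) [^] (2 ^ k :: nat) = \<one>"
    using frobenius_add[of "\<one>" x k] assms by simp
  then show ?thesis
    using assms by (intro Units_if_pow_eq_one[of _ "2 ^ k"]) auto
qed

text \<open>
  Every nonzero element of the group ring of a cyclic \<open>2\<close>-group with generator \<open>1 + s\<close> over the prime
  field is a power of \<open>s\<close> up to a unit.
\<close>

lemma binomial_sum_factor:
  fixes S :: "nat set"
  assumes s: "s \<in> carrier R"
  shows "finite S \<Longrightarrow> S \<subseteq> {..<2 ^ k} \<Longrightarrow> S \<noteq> {} \<Longrightarrow>
    \<exists>e<2 ^ k. \<exists>r\<in>carrier R. (\<Oplus>j\<in>S. (\<one> \<oplus> s) [^] j) = s [^] (e::nat) \<otimes> (\<one> \<oplus> s \<otimes> r)"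
proof (induction k arbitrary: S)
  case 0
  then have "S = {0}" by auto
  then show ?case using s by (intro exI[of _ 0] conjI bexI[of _ "\<zero>"]) auto
next
  case (Suc k)
  define p where "p = (\<lambda>S. \<Oplus>j\<in>S. (\<one> \<oplus> s) [^] (j::nat))"
  have pc [simp]: "p S \<in> carrier R" for S using s by (simp add: p_def Pi_def)
  \<comment> \<open>Splitting the exponents at \<open>2^k\<close> and using
    \<open>(1 + s)^(2^k) = 1 + s^(2^k)\<close> leads to
    \<open>p S = p (sym_diff A B) + s^(2^k) p B\<close>. The induction hypothesis is applied to the
    symmetric difference or, if that is empty, to \<open>B\<close>.\<close>
  define A where "A = S \<inter> {..<2 ^ k}"
  define B where "B = {j. j + 2 ^ k \<in> S}"
  have A: "finite A" "A \<subseteq> {..<2 ^ k}" using Suc.prems(1) by (auto simp: A_def)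
  have lt: "j < 2 * 2 ^ k" if "j \<in> S" for j using that Suc.prems(2) by (auto simp only: power_Suc)
  have B: "B \<subseteq> {..<2 ^ k}" using lt by (fastforce simp: B_def)
  then have fB: "finite B" using finite_subset by blast
  have S: "S = A \<union> (\<lambda>j. j + 2 ^ k) ` B"
  proof -
    have "x \<in> A \<union> (\<lambda>j. j + 2 ^ k) ` B" if "x \<in> S" for x
    proof (cases "x < 2 ^ k")
      case False
      then have "x = (x - 2 ^ k) + 2 ^ k" by simp
      with that show ?thesis by (force simp: B_def)
    qed (use that in \<open>simp add: A_def\<close>)
    then show ?thesis by (auto simp: A_def B_def)
  qed
  let ?q = "s [^] (2 ^ k :: nat)"
  have pow: "(\<one> \<oplus> s) [^] (j + 2 ^ k) = (\<one> \<oplus> ?q) \<otimes> (\<one> \<oplus> s) [^] j" for j :: nat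
    using s frobenius_add[of "\<one>" s k] nat_pow_mult[of "\<one> \<oplus> s" "2 ^ k" j] by (simp add: add.commute)
  have "p S = p A \<oplus> p ((\<lambda>j. j + 2 ^ k) ` B)"
    unfolding p_def using s A fB by (subst S, intro finsum_Un_disjoint) (auto simp: A_def)
  also have "p ((\<lambda>j. j + 2 ^ k) ` B) = (\<one> \<oplus> ?q) \<otimes> p B"
    unfolding p_def using s fB
    by (subst finsum_reindex) (auto simp: pow Pi_def finsum_rdistr)
  also have "p A \<oplus> (\<one> \<oplus> ?q) \<otimes> p B = (p A \<oplus> p B) \<oplus> ?q \<otimes> p B"
    using s by (simp add: l_distr a_assoc)
  also have "p A \<oplus> p B = p (sym_diff A B)"
    unfolding p_def using s A fB by (intro finsum_sym_diff[symmetric]) auto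
  finally have pS: "p S = p (sym_diff A B) \<oplus> ?q \<otimes> p B" .
  show ?case
  proof (cases "A = B")
    case True
    have "B \<noteq> {}" using S Suc.prems True by auto
    then obtain e :: nat and r where er: "e < 2 ^ k" "r \<in> carrier R" "p B = s [^] e \<otimes> (\<one> \<oplus> s \<otimes> r)"
      using Suc.IH[OF fB B] unfolding p_def by auto
    have "p S = ?q \<otimes> p B" using pS True s by (simp add: p_def)
    also have "\<dots> = s [^] (2 ^ k + e) \<otimes> (\<one> \<oplus> s \<otimes> r)"
      using er s by (simp add: nat_pow_mult[symmetric] m_assoc)
    finally show ?thesis using er(1,2) unfolding p_def by (intro exI[of _ "2 ^ k + e"] conjI bexI[of _ r]) simp_all
  next
    case False
    have "finite (sym_diff A B)" "sym_diff A B \<subseteq> {..<2 ^ k}" "sym_diff A B \<noteq> {}"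
      using False A B fB by auto
    from Suc.IH[OF this] obtain e :: nat and r where
      er: "e < 2 ^ k" "r \<in> carrier R" "p (sym_diff A B) = s [^] e \<otimes> (\<one> \<oplus> s \<otimes> r)"
      unfolding p_def by auto
    \<comment> \<open>As \<open>e < 2^k\<close>, the term \<open>s^(2^k) p B\<close> is divisible by
      \<open>s^(e+1)\<close> and only changes the cofactor of \<open>s\<close>.\<close>
    define i where "i = 2 ^ k - e - 1"
    have q: "?q = s [^] e \<otimes> (s \<otimes> s [^] i)"
      using s er nat_pow_mult[of s e "Suc i"] nat_pow_Suc2[of s i] by (simp add: i_def)
    have "p S = s [^] e \<otimes> (\<one> \<oplus> s \<otimes> (r \<oplus> s [^] i \<otimes> p B))"
      using er s by (simp add: pS q r_distr m_assoc a_assoc)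
    moreover have "e < 2 ^ Suc k" "r \<oplus> s [^] i \<otimes> p B \<in> carrier R" using er s by auto
    ultimately show ?thesis unfolding p_def by blast
  qed
qed

end

section \<open>Sections and regular wreath products\<close>

text \<open>Since the values of \<open>\<rho>\<close> centralize \<open>N\<close>, the defects of
  multiplicativity can be collected on the left. Hence \<open>N \<rho>(M)\<close> is a subgroup in
  which \<open>n \<rho>(x)\<close> conjugates \<open>N\<close> as \<open>n\<close> does, and sending
  \<open>x\<close> to the coset of \<open>\<rho> x\<close> is an isomorphism onto the quotient. This
  spares finding exact preimages of the relations of \<open>M\<close>.\<close>

lemma involved_inI:
  fixes U :: "('u, 'n) monoid_scheme" and M :: "('a, 'm) monoid_scheme"
  assumes "group U" "group M" and N: "subgroup N U"
    and \<rho>: "\<And>x. x \<in> carrier M \<Longrightarrow> \<rho> x \<in> carrier U"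
    and comm: "\<And>x n. x \<in> carrier M \<Longrightarrow> n \<in> N \<Longrightarrow> \<rho> x \<otimes>\<^bsub>U\<^esub> n = n \<otimes>\<^bsub>U\<^esub> \<rho> x"
    and mult: "\<And>x y. x \<in> carrier M \<Longrightarrow> y \<in> carrier M \<Longrightarrow>
      \<exists>n\<in>N. \<rho> x \<otimes>\<^bsub>U\<^esub> \<rho> y = n \<otimes>\<^bsub>U\<^esub> \<rho> (x \<otimes>\<^bsub>M\<^esub> y)"
    and ker: "\<And>x. x \<in> carrier M \<Longrightarrow> \<rho> x \<in> N \<Longrightarrow> x = \<one>\<^bsub>M\<^esub>"
  shows "involved_in M U"
proof -
  interpret U: group U by fact
  interpret M: group M by fact
  interpret N: subgroup N U by fact
  have nU [simp]: "n \<in> carrier U" if "n \<in> N" for n using that by simp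
  note [simp] = \<rho>
  \<comment> \<open>The value of \<open>\<rho>\<close> at the identity may differ from 1; cancelling
    in \<open>\<rho>(1) \<rho>(1) = n \<rho>(1)\<close> puts it into \<open>N\<close>.\<close>
  have one: "\<rho> \<one>\<^bsub>M\<^esub> \<in> N"
    using mult[of "\<one>\<^bsub>M\<^esub>" "\<one>\<^bsub>M\<^esub>"] by auto
  define F where "F = {n \<otimes>\<^bsub>U\<^esub> \<rho> x | n x. n \<in> N \<and> x \<in> carrier M}"
  have \<rho>F: "\<rho> x \<in> F" if "x \<in> carrier M" for x
    using that unfolding F_def by (force intro!: exI[of _ "\<one>\<^bsub>U\<^esub>"])
  have F_mult: "u \<otimes>\<^bsub>U\<^esub> v \<in> F" if uv: "u \<in> F" "v \<in> F" for u v
  proof -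
    obtain n x n' y where u: "u = n \<otimes>\<^bsub>U\<^esub> \<rho> x" "n \<in> N" "x \<in> carrier M"
      and v: "v = n' \<otimes>\<^bsub>U\<^esub> \<rho> y" "n' \<in> N" "y \<in> carrier M"
      using uv unfolding F_def by auto
    obtain n'' where n'': "n'' \<in> N" "\<rho> x \<otimes>\<^bsub>U\<^esub> \<rho> y = n'' \<otimes>\<^bsub>U\<^esub> \<rho> (x \<otimes>\<^bsub>M\<^esub> y)"
      using mult u v by blast
    have "u \<otimes>\<^bsub>U\<^esub> v = n \<otimes>\<^bsub>U\<^esub> (\<rho> x \<otimes>\<^bsub>U\<^esub> n') \<otimes>\<^bsub>U\<^esub> \<rho> y"
      using u v by (simp add: U.m_assoc)
    also have "\<dots> = n \<otimes>\<^bsub>U\<^esub> n' \<otimes>\<^bsub>U\<^esub> (\<rho> x \<otimes>\<^bsub>U\<^esub> \<rho> y)"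
      using u v by (simp add: comm U.m_assoc)
    also have "\<dots> = (n \<otimes>\<^bsub>U\<^esub> n' \<otimes>\<^bsub>U\<^esub> n'') \<otimes>\<^bsub>U\<^esub> \<rho> (x \<otimes>\<^bsub>M\<^esub> y)"
      using u v n'' by (simp add: U.m_assoc)
    finally show ?thesis
      using u v n'' unfolding F_def by blast
  qed
  have NF: "n \<in> F" if "n \<in> N" for n
  proof -
    have "n = (n \<otimes>\<^bsub>U\<^esub> inv\<^bsub>U\<^esub> \<rho> \<one>\<^bsub>M\<^esub>) \<otimes>\<^bsub>U\<^esub> \<rho> \<one>\<^bsub>M\<^esub>"
      using that by (simp add: U.m_assoc)
    then show ?thesis using that one unfolding F_def by blast
  qed
  have inv: "inv\<^bsub>U\<^esub> u \<in> F" if u: "u \<in> F" for u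
  proof -
    obtain n x where u: "u = n \<otimes>\<^bsub>U\<^esub> \<rho> x" "n \<in> N" "x \<in> carrier M"
      using u unfolding F_def by auto
    obtain n' where n': "n' \<in> N" "\<rho> (inv\<^bsub>M\<^esub> x) \<otimes>\<^bsub>U\<^esub> \<rho> x = n' \<otimes>\<^bsub>U\<^esub> \<rho> \<one>\<^bsub>M\<^esub>"
      using mult[of "inv\<^bsub>M\<^esub> x" x] u by auto
    \<comment> \<open>The product of \<open>\<rho>(x^-1)\<close> and \<open>\<rho>(x)\<close> is
      \<open>c\<close>, which lies in \<open>N\<close> but may differ from 1, so the true inverse of
      \<open>\<rho>(x)\<close> carries the correction \<open>c^-1\<close>.\<close>
    define c where "c = n' \<otimes>\<^bsub>U\<^esub> \<rho> \<one>\<^bsub>M\<^esub>"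
    have c: "c \<in> N" using n' one by (simp add: c_def)
    have "inv\<^bsub>U\<^esub> c \<otimes>\<^bsub>U\<^esub> \<rho> (inv\<^bsub>M\<^esub> x) \<otimes>\<^bsub>U\<^esub> \<rho> x = \<one>\<^bsub>U\<^esub>"
      using n' u c by (simp add: U.m_assoc flip: c_def)
    then have "inv\<^bsub>U\<^esub> (\<rho> x) = inv\<^bsub>U\<^esub> c \<otimes>\<^bsub>U\<^esub> \<rho> (inv\<^bsub>M\<^esub> x)"
      using u c by (intro U.inv_equality) auto
    then have eq: "inv\<^bsub>U\<^esub> u = (inv\<^bsub>U\<^esub> c \<otimes>\<^bsub>U\<^esub> \<rho> (inv\<^bsub>M\<^esub> x)) \<otimes>\<^bsub>U\<^esub> inv\<^bsub>U\<^esub> n"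
      using u by (simp add: U.inv_mult_group)
    show ?thesis unfolding eq using u(2,3) c by (intro F_mult NF \<rho>F) auto
  qed
  have F: "subgroup F U"
    using F_mult inv NF[OF N.one_closed] by (intro U.subgroupI) (auto simp: F_def)
  let ?F = "U\<lparr>carrier := F\<rparr>"
  interpret F: group ?F using F by (rule U.subgroup_imp_group)
  have NsubF: "subgroup N ?F"
    using N F NF by (intro U.subgroup_incl) auto
  have normal: "N \<lhd> ?F"
  proof (rule F.normal_invI[OF NsubF])
    fix u k assume uk: "u \<in> carrier ?F" "k \<in> N"
    then obtain n x where u: "u = n \<otimes>\<^bsub>U\<^esub> \<rho> x" "n \<in> N" "x \<in> carrier M"
      unfolding F_def by auto
    have inv_u: "inv\<^bsub>?F\<^esub> u = inv\<^bsub>U\<^esub> u" using F uk by (simp add: U.m_inv_consistent)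
    have "u \<otimes>\<^bsub>U\<^esub> k = n \<otimes>\<^bsub>U\<^esub> (\<rho> x \<otimes>\<^bsub>U\<^esub> k)" using u uk by (simp add: U.m_assoc)
    also have "\<dots> = (n \<otimes>\<^bsub>U\<^esub> k \<otimes>\<^bsub>U\<^esub> inv\<^bsub>U\<^esub> n) \<otimes>\<^bsub>U\<^esub> u"
      using u uk by (simp add: comm U.m_assoc) (simp add: U.m_assoc[symmetric])
    finally have "u \<otimes>\<^bsub>U\<^esub> k \<otimes>\<^bsub>U\<^esub> inv\<^bsub>U\<^esub> u = n \<otimes>\<^bsub>U\<^esub> k \<otimes>\<^bsub>U\<^esub> inv\<^bsub>U\<^esub> n"
      using u uk by (simp add: U.m_assoc)
    then show "u \<otimes>\<^bsub>?F\<^esub> k \<otimes>\<^bsub>?F\<^esub> inv\<^bsub>?F\<^esub> u \<in> N" using u uk inv_u by simp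
  qed
  interpret N: normal N ?F by fact
  let ?\<phi> = "\<lambda>x. N #>\<^bsub>?F\<^esub> \<rho> x"
  have absorb: "N #>\<^bsub>?F\<^esub> (n \<otimes>\<^bsub>U\<^esub> \<rho> x) = ?\<phi> x" if "n \<in> N" "x \<in> carrier M" for n x
  proof -
    have "(N #>\<^bsub>?F\<^esub> n) #>\<^bsub>?F\<^esub> \<rho> x = N #>\<^bsub>?F\<^esub> (n \<otimes>\<^bsub>?F\<^esub> \<rho> x)"
      using that NF \<rho>F by (intro F.coset_mult_assoc) auto
    moreover have "N #>\<^bsub>?F\<^esub> n = N" using that NsubF NF by (intro F.coset_join2) auto
    ultimately show ?thesis by simp
  qed
  have "?\<phi> \<in> hom M (?F Mod N)"
  proof (rule homI)
    fix x assume x: "x \<in> carrier M"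
    then show "?\<phi> x \<in> carrier (?F Mod N)"
      using \<rho>F by (auto simp: carrier_FactGroup)
    fix y assume y: "y \<in> carrier M"
    obtain n where n: "n \<in> N" "\<rho> x \<otimes>\<^bsub>U\<^esub> \<rho> y = n \<otimes>\<^bsub>U\<^esub> \<rho> (x \<otimes>\<^bsub>M\<^esub> y)"
      using mult x y by blast
    have "?\<phi> x <#>\<^bsub>?F\<^esub> ?\<phi> y = N #>\<^bsub>?F\<^esub> (\<rho> x \<otimes>\<^bsub>?F\<^esub> \<rho> y)"
      using x y \<rho>F by (intro N.rcos_sum) auto
    then show "?\<phi> (x \<otimes>\<^bsub>M\<^esub> y) = ?\<phi> x \<otimes>\<^bsub>?F Mod N\<^esub> ?\<phi> y"
      using n x y absorb by simp
  qed
  then interpret \<phi>: group_hom M "?F Mod N" ?\<phi>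
    using N.factorgroup_is_group M.is_group by (simp add: group_hom_def group_hom_axioms_def)
  have "?\<phi> \<in> iso M (?F Mod N)"
    unfolding \<phi>.iso_iff
  proof (intro conjI ballI impI subsetI)
    fix C assume "C \<in> carrier (?F Mod N)"
    then obtain n x where "n \<in> N" "x \<in> carrier M" "C = N #>\<^bsub>?F\<^esub> (n \<otimes>\<^bsub>U\<^esub> \<rho> x)"
      unfolding carrier_FactGroup F_def by auto
    then show "C \<in> ?\<phi> ` carrier M"
      using absorb by blast
  next
    fix x assume x: "x \<in> carrier M" "?\<phi> x = \<one>\<^bsub>?F Mod N\<^esub>"
    then have "\<rho> x \<in> N"
      using F.coset_join1[of N "\<rho> x"] NsubF \<rho>F by auto
    then show "x = \<one>\<^bsub>M\<^esub>" using ker x by blast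
  qed
  then have "?F Mod N \<cong> M"
    using M.iso_sym by (auto simp: is_iso_def)
  then show ?thesis
    unfolding involved_in_def using F normal by blast
qed

lemma carrier_regular_wreath_product:
  "carrier (regular_wreath_product A H) = (carrier H \<rightarrow>\<^sub>E carrier A) \<times> carrier H"
  and one_regular_wreath_product:
  "\<one>\<^bsub>regular_wreath_product A H\<^esub> = (\<lambda>x\<in>carrier H. \<one>\<^bsub>A\<^esub>, \<one>\<^bsub>H\<^esub>)"
  and mult_regular_wreath_product:
  "(f, h) \<otimes>\<^bsub>regular_wreath_product A H\<^esub> (g, k) =
     (\<lambda>x\<in>carrier H. f x \<otimes>\<^bsub>A\<^esub> (\<lambda>x\<in>carrier H. g (inv\<^bsub>H\<^esub> h \<otimes>\<^bsub>H\<^esub> x)) x, h \<otimes>\<^bsub>H\<^esub> k)"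
  by (simp_all add: regular_wreath_product_def semidirect_product_def)

lemma group_regular_wreath_product:
  assumes "group A" "group H"
  shows "group (regular_wreath_product A H)"
proof -
  interpret A: group A by fact
  interpret H: group H by fact
  have mult: "(f, h) \<otimes>\<^bsub>regular_wreath_product A H\<^esub> (g, k) =
     (\<lambda>x\<in>carrier H. f x \<otimes>\<^bsub>A\<^esub> g (inv\<^bsub>H\<^esub> h \<otimes>\<^bsub>H\<^esub> x), h \<otimes>\<^bsub>H\<^esub> k)" for f h g k
    by (auto simp: mult_regular_wreath_product intro!: restrict_ext)
  show ?thesis
  proof (rule groupI)
    fix x y assume "x \<in> carrier (regular_wreath_product A H)" "y \<in> carrier (regular_wreath_product A H)"
    then show "x \<otimes>\<^bsub>regular_wreath_product A H\<^esub> y \<in> carrier (regular_wreath_product A H)"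
      by (cases x; cases y) (auto simp: carrier_regular_wreath_product mult PiE_iff)
  next
    show "\<one>\<^bsub>regular_wreath_product A H\<^esub> \<in> carrier (regular_wreath_product A H)"
      by (auto simp: carrier_regular_wreath_product one_regular_wreath_product)
  next
    fix x y z assume xyz: "x \<in> carrier (regular_wreath_product A H)"
      "y \<in> carrier (regular_wreath_product A H)" "z \<in> carrier (regular_wreath_product A H)"
    then show "x \<otimes>\<^bsub>regular_wreath_product A H\<^esub> y \<otimes>\<^bsub>regular_wreath_product A H\<^esub> z =
        x \<otimes>\<^bsub>regular_wreath_product A H\<^esub> (y \<otimes>\<^bsub>regular_wreath_product A H\<^esub> z)"
      by (cases x; cases y; cases z)
        (auto simp: carrier_regular_wreath_product mult PiE_iff H.m_assoc A.m_assoc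
          H.inv_mult_group intro!: restrict_ext)
  next
    fix x assume x: "x \<in> carrier (regular_wreath_product A H)"
    obtain f h where fh: "x = (f, h)" "f \<in> carrier H \<rightarrow>\<^sub>E carrier A" "h \<in> carrier H"
      using x by (cases x) (auto simp: carrier_regular_wreath_product)
    have "(\<lambda>x\<in>carrier H. \<one>\<^bsub>A\<^esub> \<otimes>\<^bsub>A\<^esub> f x) = f"
      using fh(2) by (intro extensionalityI[of _ "carrier H"]) (auto simp: PiE_iff)
    moreover have "(\<lambda>x\<in>carrier H. \<one>\<^bsub>A\<^esub> \<otimes>\<^bsub>A\<^esub> f x) =
        (\<lambda>x\<in>carrier H. (\<lambda>x\<in>carrier H. \<one>\<^bsub>A\<^esub>) x \<otimes>\<^bsub>A\<^esub> f (inv\<^bsub>H\<^esub> \<one>\<^bsub>H\<^esub> \<otimes>\<^bsub>H\<^esub> x))"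
      by (intro restrict_ext) simp
    ultimately show "\<one>\<^bsub>regular_wreath_product A H\<^esub> \<otimes>\<^bsub>regular_wreath_product A H\<^esub> x = x"
      using fh(1,3) by (simp add: one_regular_wreath_product mult)
    show "\<exists>y\<in>carrier (regular_wreath_product A H).
        y \<otimes>\<^bsub>regular_wreath_product A H\<^esub> x = \<one>\<^bsub>regular_wreath_product A H\<^esub>"
      using fh by (intro bexI[of _ "(\<lambda>x\<in>carrier H. inv\<^bsub>A\<^esub> f (h \<otimes>\<^bsub>H\<^esub> x), inv\<^bsub>H\<^esub> h)"])
        (auto simp: carrier_regular_wreath_product one_regular_wreath_product mult PiE_iff
          intro!: restrict_ext)
  qed
qed

section \<open>Wreath products in unit groups of rings of characteristic two\<close>

text \<open>
  Modulo the group \<open>N = 1 + J\<close> below, \<open>h = 1 + t\<close> has order \<open>2 ^ k\<close> and the units \<open>1 + p c\<close>, with \<open>p\<close> a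
  polynomial in \<open>s\<close> over the prime field, form an elementary abelian group on which \<open>h\<close> acts by
  \<open>c \<mapsto> (1 + s) c\<close>. The nonvanishing condition makes this module free of rank one over the group ring
  of a cyclic group of order \<open>2 ^ k\<close>.
\<close>

locale wreath_section = char2_ring +
  fixes c t s w :: 'a and k :: nat
  assumes closed [simp]: "c \<in> carrier R" "t \<in> carrier R" "s \<in> carrier R" "w \<in> carrier R"
    and k_pos: "k > 0"
    and c_s: "c \<otimes> s = s \<otimes> c" and ts: "t \<otimes> s = s \<otimes> t"
    and c_c: "c \<otimes> c = w" and sw: "s \<otimes> w = \<zero>" and ws: "w \<otimes> s = \<zero>" and ww: "w \<otimes> w = \<zero>"
    and tt: "t \<otimes> t = s \<otimes> t \<oplus> w" and tw: "t \<otimes> w = w \<otimes> t"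
    and t_c: "t \<otimes> c = s \<otimes> c \<oplus> c \<otimes> t" and s_c_t: "s \<otimes> (c \<otimes> t) = \<zero>"
    and s_nilpotent: "s [^] (2 ^ k :: nat) = \<zero>"
    and nonvanishing: "s [^] (2 ^ k - 1 :: nat) \<otimes> c \<notin>
      {\<zero>, w, s [^] (2 ^ k - 1 :: nat) \<otimes> t, w \<oplus> s [^] (2 ^ k - 1 :: nat) \<otimes> t}"
begin

section \<open>The group of error terms and its annihilation rules\<close>

definition v where "v = s [^] (2 ^ k - 1 :: nat) \<otimes> t"
text \<open>The additive group generated by the two possible errors: \<open>w\<close> comes from
  products of units \<open>1 + p c\<close>, and \<open>v\<close> from \<open>t^(2^k)\<close>. Its
  elements multiply to zero, so \<open>1 + J\<close> is an elementary abelian group.\<close>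

definition J where "J = {\<zero>, w, v, w \<oplus> v}"
definition N where "N = (\<lambda>j. \<one> \<oplus> j) ` J"
definition h where "h = \<one> \<oplus> t"
definition L where "L = \<one> \<oplus> s"

lemma v_closed [simp]: "v \<in> carrier R" by (simp add: v_def)
lemma h_closed [simp]: "h \<in> carrier R" by (simp add: h_def)
lemma L_closed [simp]: "L \<in> carrier R" by (simp add: L_def)
lemma J_closed [simp]: "j \<in> J \<Longrightarrow> j \<in> carrier R" by (auto simp: J_def)
lemma N_closed [simp]: "n \<in> N \<Longrightarrow> n \<in> carrier R" by (auto simp: N_def)

lemma m_ge_2: "(2::nat) \<le> 2 ^ k"
  using k_pos by (cases k) auto

lemma pow_commute:
  assumes "x \<in> carrier R" "y \<in> carrier R" "x \<otimes> y = y \<otimes> x"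
  shows "x \<otimes> y [^] (n::nat) = y [^] n \<otimes> x"
  using assms by (metis group_commutes_pow)

lemma s_pow_annihilates:
  assumes "x \<in> carrier R" "s \<otimes> x = \<zero>" "n > 0"
  shows "s [^] (n::nat) \<otimes> x = \<zero>"
  using assms by (cases n) (auto simp: m_assoc)

lemma s_pow_pred: "s [^] (2 ^ k - 1 :: nat) \<otimes> s = \<zero>" "s \<otimes> s [^] (2 ^ k - 1 :: nat) = \<zero>"
proof -
  show "s [^] (2 ^ k - 1 :: nat) \<otimes> s = \<zero>"
    using s_nilpotent nat_pow_Suc[of s "2 ^ k - 1"] by simp
  then show "s \<otimes> s [^] (2 ^ k - 1 :: nat) = \<zero>"
    by (simp add: pow_commute)
qed

text \<open>The factor \<open>s^(2^k - 1)\<close> of \<open>v\<close> is killed by one more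
  \<open>s\<close>. It also kills \<open>w\<close> and \<open>c t\<close>, its exponent being
  positive, so the relations for \<open>t t\<close> and \<open>t c\<close> leave nothing.\<close>

lemma v_annihilates:
  "s \<otimes> v = \<zero>" "v \<otimes> s = \<zero>" "c \<otimes> v = \<zero>" "v \<otimes> c = \<zero>" "t \<otimes> v = \<zero>" "v \<otimes> t = \<zero>"
  "v \<otimes> w = \<zero>" "w \<otimes> v = \<zero>" "v \<otimes> v = \<zero>"
proof -
  note One_nat_def [simp del]
  let ?q = "s [^] (2 ^ k - 1 :: nat)"
  have q: "?q \<otimes> w = \<zero>" "?q \<otimes> (c \<otimes> t) = \<zero>"
    using m_ge_2 by (auto intro!: s_pow_annihilates simp: sw s_c_t)
  have qs: "?q \<otimes> (s \<otimes> x) = \<zero>" if "x \<in> carrier R" for x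
    using that by (simp add: m_assoc[symmetric] s_pow_pred)
  have cm: "c \<otimes> ?q = ?q \<otimes> c" "t \<otimes> ?q = ?q \<otimes> t" "w \<otimes> ?q = ?q \<otimes> w"
    by (auto intro!: pow_commute simp: c_s ts sw ws)
  show "s \<otimes> v = \<zero>" by (simp add: v_def m_assoc[symmetric] s_pow_pred)
  show "v \<otimes> s = \<zero>" by (simp add: v_def m_assoc ts qs)
  have "c \<otimes> v = ?q \<otimes> (c \<otimes> t)" by (simp add: v_def cm flip: m_assoc)
  then show "c \<otimes> v = \<zero>" by (simp add: q)
  show "v \<otimes> c = \<zero>" by (simp add: v_def m_assoc t_c r_distr qs q)
  have vt: "?q \<otimes> (t \<otimes> t) = \<zero>" by (simp add: tt r_distr qs q)
  then show "v \<otimes> t = \<zero>" by (simp add: v_def m_assoc)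
  have "t \<otimes> v = ?q \<otimes> (t \<otimes> t)" by (simp add: v_def cm flip: m_assoc)
  then show tv: "t \<otimes> v = \<zero>" by (simp add: vt)
  show "v \<otimes> v = \<zero>" using tv by (simp add: v_def m_assoc)
  have "w \<otimes> v = (w \<otimes> ?q) \<otimes> t" by (simp add: v_def m_assoc)
  then show "w \<otimes> v = \<zero>" by (simp add: cm q)
  have "v \<otimes> w = (?q \<otimes> w) \<otimes> t" by (simp add: v_def m_assoc tw)
  then show "v \<otimes> w = \<zero>" by (simp add: q)
qed

lemma c_w: "c \<otimes> w = w \<otimes> c"
  by (simp add: c_c[symmetric] m_assoc)

lemma J_props:
  assumes "i \<in> J" "j \<in> J"
  shows "c \<otimes> j = j \<otimes> c" "t \<otimes> j = j \<otimes> t" "s \<otimes> j = \<zero>" "j \<otimes> s = \<zero>" "i \<otimes> j = \<zero>" "i \<oplus> j \<in> J"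
  using assms unfolding J_def
  by (auto simp: v_annihilates c_w tw sw ws ww r_distr l_distr a_ac)

lemma zero_in_J: "\<zero> \<in> J" and w_in_J: "w \<in> J" by (simp_all add: J_def)

lemma one_in_N: "\<one> \<in> N" using zero_in_J unfolding N_def by force

lemma N_mult: "n \<in> N \<Longrightarrow> n' \<in> N \<Longrightarrow> n \<otimes> n' \<in> N"
proof -
  assume "n \<in> N" "n' \<in> N"
  then obtain i j where ij: "n = \<one> \<oplus> i" "n' = \<one> \<oplus> j" "i \<in> J" "j \<in> J" by (auto simp: N_def)
  then have "n \<otimes> n' = \<one> \<oplus> (i \<oplus> j)"
    by (simp add: l_distr r_distr J_props a_ac)
  then show ?thesis using ij J_props(6) by (auto simp: N_def)
qed

lemma N_self_inverse: "n \<in> N \<Longrightarrow> n \<otimes> n = \<one>"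
  by (auto simp: N_def l_distr r_distr J_props a_ac)

lemma N_commute:
  assumes "n \<in> N"
  shows "c \<otimes> n = n \<otimes> c" "h \<otimes> n = n \<otimes> h" "L \<otimes> n = n \<otimes> L" "s \<otimes> n = n \<otimes> s"
  using assms by (auto simp: N_def h_def L_def l_distr r_distr J_props a_ac)

section \<open>The action of \<open>h\<close> on \<open>c\<close> and the order of \<open>h\<close>
  modulo \<open>N\<close>\<close>

lemma L_commute: "c \<otimes> L = L \<otimes> c" "h \<otimes> L = L \<otimes> h"
  by (auto simp: h_def L_def l_distr r_distr c_s ts a_ac)

text \<open>Expanding both sides with \<open>t c = s c + c t\<close>, they differ by
  \<open>s (c t)\<close>, which is zero.\<close>

lemma h_c: "h \<otimes> c = L \<otimes> (c \<otimes> h)"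
  by (simp add: h_def L_def l_distr r_distr t_c s_c_t a_ac)

lemma h_pow_c: "h [^] (i::nat) \<otimes> c = L [^] i \<otimes> (c \<otimes> h [^] i)"
proof (induction i)
  case (Suc i)
  have "h [^] Suc i \<otimes> c = (h [^] i \<otimes> L) \<otimes> (c \<otimes> h)"
    by (simp add: m_assoc h_c)
  also have "h [^] i \<otimes> L = L \<otimes> h [^] i"
    using L_commute by (intro pow_commute[symmetric]) auto
  also have "L \<otimes> h [^] i \<otimes> (c \<otimes> h) = L \<otimes> (h [^] i \<otimes> c) \<otimes> h"
    by (simp add: m_assoc)
  also have "\<dots> = (L \<otimes> L [^] i) \<otimes> (c \<otimes> (h [^] i \<otimes> h))"
    by (simp add: Suc m_assoc)
  also have "L \<otimes> L [^] i = L [^] Suc i"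
    using nat_pow_Suc2[of L i] by simp
  finally show ?case by simp
qed simp

lemma L_pow: "L [^] (2 ^ k :: nat) = \<one>"
  using frobenius_add[of "\<one>" s k] by (simp add: L_def s_nilpotent)

lemma L_pow_mod: "L [^] (i mod 2 ^ k) = L [^] (i::nat)"
proof -
  have "L [^] i = L [^] (2 ^ k * (i div 2 ^ k) + i mod 2 ^ k)" by simp
  also have "\<dots> = L [^] (i mod 2 ^ k)"
    by (subst nat_pow_mult[symmetric]) (simp_all add: nat_pow_pow[symmetric] L_pow)
  finally show ?thesis by simp
qed

text \<open>Squaring \<open>q t + e\<close> leaves \<open>q^2 t^2 = q^2 (s t + w)\<close>, with
  \<open>q\<close> a power of \<open>s\<close>. Only the first squaring, where \<open>q = 1\<close>,
  can contribute \<open>w\<close>; afterwards \<open>q^2\<close> has positive exponent and kills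
  it.\<close>

lemma t_pow: "j > 0 \<Longrightarrow> \<exists>e\<in>{\<zero>, w}. t [^] (2 ^ j :: nat) = s [^] (2 ^ j - 1 :: nat) \<otimes> t \<oplus> e"
proof (induction j rule: nat_induct_non_zero)
  case 1
  have "t [^] (2 ^ 1 :: nat) = t \<otimes> t" by (simp add: numeral_2_eq_2)
  then show ?case by (auto simp: tt)
next
  case (Suc j)
  then obtain e where e: "e \<in> {\<zero>, w}" "t [^] (2 ^ j :: nat) = s [^] (2 ^ j - 1 :: nat) \<otimes> t \<oplus> e"
    by blast
  let ?q = "s [^] (2 ^ j - 1 :: nat)"
  have [simp]: "e \<in> carrier R" and ee: "e \<otimes> e = \<zero>" and te: "t \<otimes> e = e \<otimes> t" and se: "s \<otimes> e = e \<otimes> s"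
    using e by (auto simp: ww tw sw ws)
  have "e \<otimes> ?q = ?q \<otimes> e" by (rule pow_commute) (simp_all add: se)
  then have comm: "?q \<otimes> t \<otimes> e = e \<otimes> (?q \<otimes> t)" by (simp add: m_assoc te flip: m_assoc[of e])
  have tq: "t \<otimes> ?q = ?q \<otimes> t" by (rule pow_commute) (simp_all add: ts)
  have "2 \<le> (2::nat) ^ j" using Suc by (cases j) auto
  then have exp: "(2 ^ j - 1) + (2 ^ j - 1) + 1 = (2 ^ Suc j - 1 :: nat)" and
    pos: "(2 ^ j - 1) + (2 ^ j - 1) > (0::nat)" by auto
  have "t [^] (2 ^ Suc j :: nat) = (?q \<otimes> t \<oplus> e) \<otimes> (?q \<otimes> t \<oplus> e)"
    by (simp add: nat_pow_double e(2))
  also have "\<dots> = (?q \<otimes> t) \<otimes> (?q \<otimes> t)"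
    using comm by (simp add: square_add ee)
  also have "\<dots> = ?q \<otimes> (t \<otimes> ?q) \<otimes> t" by (simp add: m_assoc)
  also have "\<dots> = (?q \<otimes> ?q) \<otimes> (s \<otimes> t \<oplus> w)"
    unfolding tq tt[symmetric] by (simp add: m_assoc)
  also have "?q \<otimes> ?q = s [^] ((2 ^ j - 1) + (2 ^ j - 1) :: nat)" by (simp add: nat_pow_mult)
  also have "\<dots> \<otimes> (s \<otimes> t \<oplus> w) = s [^] (2 ^ Suc j - 1 :: nat) \<otimes> t"
    unfolding exp[symmetric] using s_pow_annihilates[OF closed(4) sw pos]
    by (simp add: r_distr m_assoc)
  finally show ?case by auto
qed

lemma t_pow_in_J: "t [^] (2 ^ k :: nat) \<in> J"
  using t_pow[OF k_pos] by (auto simp: J_def v_def a_comm)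

lemma h_pow_in_N: "h [^] (2 ^ k :: nat) \<in> N"
  using frobenius_add[of "\<one>" t k] t_pow_in_J by (simp add: h_def N_def)

lemma h_pow_mod: "\<exists>n\<in>N. h [^] (i::nat) = n \<otimes> h [^] (i mod 2 ^ k)"
proof -
  have "n [^] (j::nat) \<in> N" if "n \<in> N" for n j
    using that by (induction j) (auto simp: one_in_N N_mult)
  moreover have "h [^] i = h [^] (2 ^ k * (i div 2 ^ k) + i mod 2 ^ k)" by simp
  then have "h [^] i = (h [^] (2 ^ k :: nat)) [^] (i div 2 ^ k) \<otimes> h [^] (i mod 2 ^ k)"
    by (simp only: nat_pow_mult[symmetric] nat_pow_pow h_closed)
  ultimately show ?thesis using h_pow_in_N by blast
qed

section \<open>Polynomials in \<open>L\<close> over the prime field\<close>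

text \<open>A function from the index group to \<open>C_2\<close> is stored as its support
  \<open>S\<close>. The sum is the corresponding element of the group ring of a cyclic group
  generated by \<open>L\<close>, so that symmetric difference of supports becomes addition.\<close>

definition P :: "('i \<Rightarrow> nat) \<Rightarrow> 'i set \<Rightarrow> 'a" where
  "P ix S = (\<Oplus>u\<in>S. L [^] ix u)"

lemma P_closed [simp]: "P ix S \<in> carrier R"
  by (simp add: P_def Pi_def)

lemma P_commute:
  assumes "x \<in> carrier R" "x \<otimes> L = L \<otimes> x"
  shows "x \<otimes> P ix S = P ix S \<otimes> x"
proof (cases "finite S")
  case True
  have "x \<otimes> P ix S = (\<Oplus>u\<in>S. x \<otimes> L [^] ix u)"
    unfolding P_def using assms True by (subst finsum_rdistr) (auto simp: Pi_def)
  also have "\<dots> = (\<Oplus>u\<in>S. L [^] ix u \<otimes> x)"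
    using assms by (intro finsum_cong') (auto intro!: pow_commute)
  also have "\<dots> = P ix S \<otimes> x"
    unfolding P_def using assms True by (subst finsum_ldistr) (auto simp: Pi_def)
  finally show ?thesis .
qed (use assms in \<open>simp add: P_def\<close>)

text \<open>\<open>L\<close> fixes \<open>w\<close> because \<open>s w = 0\<close>, so a sum of
  powers of \<open>L\<close> acts on \<open>w\<close> through the parity of the number of
  summands.\<close>

lemma P_w: "P ix S \<otimes> w = \<zero> \<or> P ix S \<otimes> w = w"
proof (cases "finite S")
  case True
  have Lw: "L [^] n \<otimes> w = w" for n :: nat
  proof (induction n)
    case (Suc n)
    have "L [^] Suc n \<otimes> w = L [^] n \<otimes> (L \<otimes> w)" by (simp add: m_assoc)
    also have "L \<otimes> w = w" by (simp add: L_def l_distr sw)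
    finally show ?case using Suc by simp
  qed simp
  show ?thesis using True
  proof (induction S)
    case (insert u S)
    then have "P ix (insert u S) \<otimes> w = w \<oplus> P ix S \<otimes> w"
      by (simp add: P_def Pi_def l_distr Lw)
    then show ?case using insert by auto
  qed (simp add: P_def)
qed (simp add: P_def)

lemma P_sym_diff:
  "finite S \<Longrightarrow> finite T \<Longrightarrow> P ix (sym_diff S T) = P ix S \<oplus> P ix T"
  unfolding P_def by (intro finsum_sym_diff) auto

text \<open>By \<open>binomial_sum_factor\<close> the polynomial is \<open>s^e (1 + s r)\<close>
  with \<open>e < 2^k\<close>; after multiplication by \<open>s^(2^k - 1 - e)\<close> the cofactor
  acts as 1, since \<open>s^(2^k) = 0\<close>.\<close>

lemma P_factor:
  assumes "inj_on ix S" "ix ` S \<subseteq> {..<2 ^ k}" "S \<noteq> {}"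
  shows "\<exists>d. s [^] (d::nat) \<otimes> P ix S = s [^] (2 ^ k - 1 :: nat)"
proof -
  have "finite (ix ` S)" using assms(2) finite_subset by blast
  then obtain e :: nat and r where er: "e < 2 ^ k" "r \<in> carrier R"
      "(\<Oplus>j\<in>ix ` S. L [^] j) = s [^] e \<otimes> (\<one> \<oplus> s \<otimes> r)"
    using binomial_sum_factor[of s "ix ` S" k] assms unfolding L_def by auto
  have "P ix S = (\<Oplus>j\<in>ix ` S. L [^] j)"
    unfolding P_def using assms by (subst finsum_reindex) auto
  then have "s [^] (2 ^ k - 1 - e) \<otimes> P ix S = s [^] (2 ^ k - 1 - e) \<otimes> s [^] e \<otimes> (\<one> \<oplus> s \<otimes> r)"
    using er by (simp add: m_assoc)
  also have "s [^] (2 ^ k - 1 - e) \<otimes> s [^] e = s [^] (2 ^ k - 1 :: nat)"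
    using er by (simp add: nat_pow_mult)
  also have "\<dots> \<otimes> (\<one> \<oplus> s \<otimes> r) = s [^] (2 ^ k - 1 :: nat)"
    using er by (simp add: r_distr s_pow_pred del: One_nat_def flip: m_assoc)
  finally show ?thesis by blast
qed

lemma P_c_notin_J:
  assumes "inj_on ix S" "ix ` S \<subseteq> {..<2 ^ k}" "S \<noteq> {}"
  shows "P ix S \<otimes> c \<notin> J"
proof
  assume J: "P ix S \<otimes> c \<in> J"
  obtain d :: nat where d: "s [^] d \<otimes> P ix S = s [^] (2 ^ k - 1 :: nat)"
    using P_factor[OF assms] by auto
  \<comment> \<open>\<open>s\<close> annihilates \<open>J\<close>, so \<open>s^d\<close> maps it
    into itself: identically if \<open>d = 0\<close>, to zero otherwise.\<close>
  have "s [^] d \<otimes> (P ix S \<otimes> c) \<in> J"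
  proof (cases "d = 0")
    case False
    then show ?thesis
      using s_pow_annihilates[of "P ix S \<otimes> c" d] J J_props(3)[OF J J] zero_in_J by simp
  qed (use J in simp)
  moreover have "s [^] d \<otimes> (P ix S \<otimes> c) = s [^] (2 ^ k - 1 :: nat) \<otimes> c"
    by (simp add: d flip: m_assoc)
  ultimately show False using nonvanishing by (auto simp: J_def v_def)
qed

section \<open>Coset representatives of the wreath product\<close>

text \<open>\<open>S\<close> is the support of the base component and \<open>i\<close> the index of
  the top component. This is the map handed to \<open>involved_inI\<close>; it is multiplicative
  only modulo \<open>N\<close>.\<close>

definition \<rho> :: "('i \<Rightarrow> nat) \<Rightarrow> 'i set \<Rightarrow> nat \<Rightarrow> 'a" where
  "\<rho> ix S i = (\<one> \<oplus> P ix S \<otimes> c) \<otimes> h [^] i"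

lemma \<rho>_closed [simp]: "\<rho> ix S i \<in> carrier R" by (simp add: \<rho>_def)

lemma P_c_P_c: "(P ix S \<otimes> c) \<otimes> (P ix T \<otimes> c) = P ix S \<otimes> (P ix T \<otimes> w)"
proof -
  have "c \<otimes> P ix T = P ix T \<otimes> c" by (rule P_commute) (simp_all add: L_commute)
  then have "P ix S \<otimes> (c \<otimes> P ix T) \<otimes> c = P ix S \<otimes> (P ix T \<otimes> w)"
    by (simp add: m_assoc c_c)
  then show ?thesis by (simp add: m_assoc)
qed

text \<open>The cross term \<open>p q w\<close> is zero unless both \<open>p\<close> and
  \<open>q\<close> fix \<open>w\<close>. In that case it equals \<open>w\<close>, and
  \<open>(p + q) w = 0\<close>, so the factor \<open>1 + w\<close> of \<open>N\<close> accounts for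
  it exactly.\<close>

lemma P_c_mult:
  "\<exists>n\<in>N. (\<one> \<oplus> P ix S \<otimes> c) \<otimes> (\<one> \<oplus> P ix T \<otimes> c) = n \<otimes> (\<one> \<oplus> (P ix S \<oplus> P ix T) \<otimes> c)"
proof -
  let ?p = "P ix S" and ?q = "P ix T"
  have wP: "w \<otimes> P ix S = P ix S \<otimes> w" for S
    by (rule P_commute) (simp_all add: L_def l_distr r_distr sw ws)
  have eq: "(\<one> \<oplus> ?p \<otimes> c) \<otimes> (\<one> \<oplus> ?q \<otimes> c) = \<one> \<oplus> (?p \<oplus> ?q) \<otimes> c \<oplus> ?p \<otimes> (?q \<otimes> w)"
    by (simp add: l_distr r_distr a_ac P_c_P_c)
  show ?thesis
  proof (cases "?p \<otimes> w = w \<and> ?q \<otimes> w = w")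
    case True
    have "w \<otimes> ((?p \<oplus> ?q) \<otimes> c) = (?p \<otimes> w \<oplus> ?q \<otimes> w) \<otimes> c"
      by (simp add: l_distr r_distr wP flip: m_assoc)
    also have "\<dots> = \<zero>" using True by simp
    finally have "(\<one> \<oplus> w) \<otimes> (\<one> \<oplus> (?p \<oplus> ?q) \<otimes> c) = \<one> \<oplus> (?p \<oplus> ?q) \<otimes> c \<oplus> w"
      by (simp add: l_distr r_distr a_ac)
    then show ?thesis using True eq w_in_J by (intro bexI[of _ "\<one> \<oplus> w"]) (auto simp: N_def)
  next
    case False
    then have "?p \<otimes> (?q \<otimes> w) = \<zero>" using P_w[of ix S] P_w[of ix T] by auto
    then show ?thesis using eq one_in_N by (intro bexI[of _ "\<one>"]) auto
  qed
qed

lemma N_commute_P: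
  assumes "n \<in> N"
  shows "(\<one> \<oplus> P ix S \<otimes> c) \<otimes> n = n \<otimes> (\<one> \<oplus> P ix S \<otimes> c)"
proof -
  have "P ix S \<otimes> c \<otimes> n = P ix S \<otimes> n \<otimes> c"
    using assms by (simp add: N_commute m_assoc)
  also have "P ix S \<otimes> n = n \<otimes> P ix S"
    using assms by (intro P_commute[symmetric]) (auto simp: N_commute)
  finally show ?thesis using assms by (simp add: l_distr r_distr m_assoc)
qed

lemma \<rho>_commute:
  assumes "n \<in> N"
  shows "\<rho> ix S i \<otimes> n = n \<otimes> \<rho> ix S i"
proof -
  have "h [^] i \<otimes> n = n \<otimes> h [^] i"
    using assms by (intro pow_commute[symmetric]) (auto simp: N_commute)
  then have "\<rho> ix S i \<otimes> n = ((\<one> \<oplus> P ix S \<otimes> c) \<otimes> n) \<otimes> h [^] i"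
    using assms by (simp add: \<rho>_def m_assoc)
  then show ?thesis using assms by (simp add: N_commute_P \<rho>_def m_assoc)
qed

text \<open>\<open>T'\<close> plays the translate of \<open>T\<close> by the element of index
  \<open>i\<close>: moving \<open>h^i\<close> past \<open>1 + P ix T c\<close> multiplies the
  polynomial by \<open>L^i\<close>. The elements of \<open>N\<close> come from the product of the
  two base parts and from reducing the exponent of \<open>h\<close>.\<close>

lemma \<rho>_mult:
  assumes "finite S" "finite T" and T': "P ix T' = L [^] i \<otimes> P ix T" "finite T'"
  shows "\<exists>n\<in>N. \<rho> ix S i \<otimes> \<rho> ix T j = n \<otimes> \<rho> ix (sym_diff S T') ((i + j) mod 2 ^ k)"
proof -
  have hP: "h [^] i \<otimes> P ix T = P ix T \<otimes> h [^] i"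
    by (rule P_commute) (simp_all add: pow_commute[symmetric] L_commute)
  have PL: "P ix T \<otimes> L [^] i = L [^] i \<otimes> P ix T"
    by (rule P_commute[symmetric]) (simp_all add: pow_commute[symmetric])
  have "h [^] i \<otimes> (P ix T \<otimes> c) = P ix T \<otimes> (h [^] i \<otimes> c)"
    by (simp add: hP flip: m_assoc)
  also have "\<dots> = (P ix T' \<otimes> c) \<otimes> h [^] i"
    by (simp add: h_pow_c T' PL flip: m_assoc)
  finally have "h [^] i \<otimes> (\<one> \<oplus> P ix T \<otimes> c) = (\<one> \<oplus> P ix T' \<otimes> c) \<otimes> h [^] i"
    by (simp add: l_distr r_distr)
  then have "\<rho> ix S i \<otimes> \<rho> ix T j =
      (\<one> \<oplus> P ix S \<otimes> c) \<otimes> ((\<one> \<oplus> P ix T' \<otimes> c) \<otimes> h [^] i) \<otimes> h [^] j"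
    by (simp add: \<rho>_def m_assoc) (simp add: m_assoc[symmetric])
  also have "\<dots> = ((\<one> \<oplus> P ix S \<otimes> c) \<otimes> (\<one> \<oplus> P ix T' \<otimes> c)) \<otimes> h [^] (i + j)"
    by (simp add: m_assoc nat_pow_mult)
  also obtain n where n: "n \<in> N" "(\<one> \<oplus> P ix S \<otimes> c) \<otimes> (\<one> \<oplus> P ix T' \<otimes> c) =
      n \<otimes> (\<one> \<oplus> P ix (sym_diff S T') \<otimes> c)"
    using P_c_mult P_sym_diff assms by metis
  note this(2)
  also obtain n' where n': "n' \<in> N" "h [^] (i + j) = n' \<otimes> h [^] ((i + j) mod 2 ^ k)"
    using h_pow_mod by blast
  note this(2)
  also have "n \<otimes> (\<one> \<oplus> P ix (sym_diff S T') \<otimes> c) \<otimes> (n' \<otimes> h [^] ((i + j) mod 2 ^ k)) =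
      n \<otimes> ((\<one> \<oplus> P ix (sym_diff S T') \<otimes> c) \<otimes> n') \<otimes> h [^] ((i + j) mod 2 ^ k)"
    using n n' by (simp add: m_assoc)
  also have "\<dots> = (n \<otimes> n') \<otimes> \<rho> ix (sym_diff S T') ((i + j) mod 2 ^ k)"
    using n n' by (simp add: N_commute_P \<rho>_def m_assoc)
  finally show ?thesis using n n' N_mult by blast
qed

text \<open>An element of \<open>N\<close> commutes with \<open>c\<close>, whereas moving
  \<open>c\<close> through \<open>h^i\<close> produces \<open>L^i\<close>. Hence
  \<open>c = L^i c\<close>, which contradicts \<open>nonvanishing\<close> unless
  \<open>i = 0\<close>; what remains is excluded by \<open>P_c_notin_J\<close>.\<close>

lemma \<rho>_kernel:
  assumes "inj_on ix S" "ix ` S \<subseteq> {..<2 ^ k}" "i < 2 ^ k" and N: "\<rho> ix S i \<in> N"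
  shows "S = {} \<and> i = 0"
proof -
  let ?p = "\<one> \<oplus> P ix S \<otimes> c" and ?n = "\<rho> ix S i"
  have XP: "c \<otimes> P ix S = P ix S \<otimes> c" by (rule P_commute) (simp_all add: L_commute)
  then have Xp: "c \<otimes> ?p = ?p \<otimes> c" by (simp add: l_distr r_distr flip: m_assoc)
  have "L [^] i \<otimes> P ix S = P ix S \<otimes> L [^] i"
    by (rule P_commute) (simp_all add: pow_commute[symmetric])
  moreover have LX: "L [^] i \<otimes> c = c \<otimes> L [^] i"
    by (rule pow_commute[symmetric]) (simp_all add: L_commute)
  ultimately have Lp: "L [^] i \<otimes> ?p = ?p \<otimes> L [^] i"
    by (simp add: l_distr r_distr m_assoc flip: m_assoc[of "L [^] i" "P ix S" c])
  have "c \<otimes> ?n = ?n \<otimes> c" using N by (simp add: N_commute)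
  also have "\<dots> = (?p \<otimes> L [^] i) \<otimes> (c \<otimes> h [^] i)"
    by (simp add: \<rho>_def m_assoc h_pow_c)
  also have "\<dots> = L [^] i \<otimes> (?p \<otimes> c) \<otimes> h [^] i"
    by (simp add: Lp[symmetric] m_assoc)
  also have "\<dots> = L [^] i \<otimes> c \<otimes> ?n"
    by (simp add: Xp[symmetric] m_assoc \<rho>_def)
  finally have "c \<otimes> ?n \<otimes> ?n = L [^] i \<otimes> c \<otimes> ?n \<otimes> ?n" by simp
  then have c_fixed: "c = L [^] i \<otimes> c"
    using N_self_inverse[OF N] by (simp add: m_assoc)
  have i: "i = 0"
  proof (rule ccontr)
    assume "i \<noteq> 0"
    \<comment> \<open>The annihilator \<open>1 + L^i\<close> of \<open>c\<close> is the polynomial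
      with exponent set \<open>{0, i}\<close>, so some power of \<open>s\<close> turns it into
      \<open>s^(2^k - 1)\<close>.\<close>
    obtain d :: nat where d: "s [^] d \<otimes> P id {0, i} = s [^] (2 ^ k - 1 :: nat)"
      using P_factor[of id "{0, i}"] assms by auto
    have "P id {0, i} \<otimes> c = c \<oplus> L [^] i \<otimes> c"
      using \<open>i \<noteq> 0\<close> by (simp add: P_def Pi_def l_distr)
    also have "\<dots> = \<zero>" using c_fixed by simp
    finally have "s [^] (2 ^ k - 1 :: nat) \<otimes> c = \<zero>"
      by (simp add: d[symmetric] m_assoc del: One_nat_def)
    then show False using nonvanishing by simp
  qed
  then have "\<one> \<oplus> P ix S \<otimes> c \<in> N" using N by (simp add: \<rho>_def)
  then obtain j where j: "j \<in> J" "\<one> \<oplus> P ix S \<otimes> c = \<one> \<oplus> j" by (auto simp: N_def)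
  then have "P ix S \<otimes> c = j" by simp
  then have "S = {}" using P_c_notin_J assms j by blast
  with i show ?thesis by simp
qed

text \<open>\<open>ix\<close> identifies \<open>H\<close> with the integers modulo
  \<open>2^k\<close>, and \<open>\<epsilon>\<close> stands for the augmentation. A homomorphism into
  a domain kills nilpotent elements, which places every \<open>1 + x\<close> with \<open>x\<close>
  nilpotent of the kind used here in \<open>U\<close>.\<close>

lemma wreath_product_involved:
  fixes H :: "('h, 'n) monoid_scheme" and U :: "('a, 'p) monoid_scheme" and K :: "('k, 'q) ring_scheme"
    and ix :: "'h \<Rightarrow> nat"
  assumes H: "group H" and ix: "bij_betw ix (carrier H) {..<2 ^ k}"
    and ix_mult: "\<And>x y. x \<in> carrier H \<Longrightarrow> y \<in> carrier H \<Longrightarrow>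
      ix (x \<otimes>\<^bsub>H\<^esub> y) = (ix x + ix y) mod 2 ^ k"
    and U: "group U" "carrier U = {u \<in> Units R. \<epsilon> u = \<one>\<^bsub>K\<^esub>}"
      "monoid.mult U = monoid.mult R" "\<one>\<^bsub>U\<^esub> = \<one>"
    and K: "domain K" "\<epsilon> \<in> ring_hom R K"
  shows "involved_in (regular_wreath_product (integer_mod_group 2) H) U"
proof -
  interpret H: group H by fact
  interpret U: group U by fact
  interpret K: domain K by fact
  interpret \<epsilon>: ring_hom_ring R K \<epsilon>
    using ring_axioms K.ring_axioms K(2) by (rule ring_hom_ringI2)
  have fin: "finite (carrier H)"
    using bij_betw_finite[OF ix] by simp
  have ix_less: "ix x < 2 ^ k" if "x \<in> carrier H" for x
    using bij_betwE[OF ix] that by auto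
  have inj: "inj_on ix S" if "S \<subseteq> carrier H" for S
    using inj_on_subset[OF bij_betw_imp_inj_on[OF ix] that] .
  have "ix \<one>\<^bsub>H\<^esub> = (ix \<one>\<^bsub>H\<^esub> + ix \<one>\<^bsub>H\<^esub>) mod 2 ^ k"
    using ix_mult[of "\<one>\<^bsub>H\<^esub>" "\<one>\<^bsub>H\<^esub>"] by simp
  then have ix_one: "ix \<one>\<^bsub>H\<^esub> = 0"
    using ix_less[OF H.one_closed] by (auto simp: mod_if split: if_splits)
  have \<epsilon>_nil: "\<epsilon> (x [^] (2 ^ j :: nat)) = \<zero>\<^bsub>K\<^esub> \<Longrightarrow> \<epsilon> x = \<zero>\<^bsub>K\<^esub>" if "x \<in> carrier R" for x j
    using that by (induction j) (auto simp: nat_pow_double K.integral_iff)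
  have unit: "\<one> \<oplus> x \<in> carrier U" if "x \<in> carrier R" "x [^] (2 ^ j :: nat) = \<zero>" for x j
    using that one_plus_nilpotent_Units[of x j] \<epsilon>_nil[of x j] by (simp add: U)
  have sq: "x [^] (2 ^ Suc 0 :: nat) = x \<otimes> x" if "x \<in> carrier R" for x
    using that by (simp add: numeral_2_eq_2)
  have N_U: "N \<subseteq> carrier U"
  proof
    fix n assume "n \<in> N"
    then obtain j where "j \<in> J" "n = \<one> \<oplus> j" by (auto simp: N_def)
    then show "n \<in> carrier U" using unit[of j "Suc 0"] sq[of j] J_props(5)[of j j] by simp
  qed
  have N: "subgroup N U"
  proof (rule U.subgroupI)
    fix n assume n: "n \<in> N"
    have "inv\<^bsub>U\<^esub> n = n"
      using n N_U N_self_inverse by (intro U.inv_equality) (auto simp: U)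
    then show "inv\<^bsub>U\<^esub> n \<in> N" using n by simp
  qed (use N_U one_in_N N_mult in \<open>auto simp: U(3)\<close>)
  have "t [^] (2 ^ Suc k :: nat) = \<zero>"
    using J_props(5)[OF t_pow_in_J t_pow_in_J] by (simp add: nat_pow_double)
  then have "h \<in> carrier U" using unit[of t "Suc k"] by (simp add: h_def)
  then have h_U: "h [^] i \<in> carrier U" for i :: nat
  proof (induction i)
    case (Suc i)
    then show ?case using U.m_closed[of "h [^] i" h] by (simp add: U(3))
  qed (use U.one_closed in \<open>simp add: U(4)\<close>)
  have P_U: "\<one> \<oplus> P ix S \<otimes> c \<in> carrier U" for S
  proof -
    let ?x = "P ix S \<otimes> c"
    \<comment> \<open>The square lies in \<open>J\<close>, where products vanish, so the fourth
      power is zero.\<close>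
    have "?x \<otimes> ?x \<in> J" using P_w[of ix S] by (auto simp: P_c_P_c J_def)
    then have "?x [^] (2 ^ 2 :: nat) = \<zero>"
      using nat_pow_double[of ?x 2] nat_pow_double[of ?x 1] J_props(5) by simp
    with unit[of ?x 2] show ?thesis by simp
  qed
  \<comment> \<open>The carrier of \<open>integer_mod_group 2\<close> consists of the integers 0 and
    1, so an extensional function is determined by the places where it is 1.\<close>
  define supp where "supp f = {u \<in> carrier H. f u = 1}" for f :: "'h \<Rightarrow> int"
  have supp: "supp f \<subseteq> carrier H" "finite (supp f)" for f
    using fin by (auto simp: supp_def)
  let ?W = "regular_wreath_product (integer_mod_group 2) H"
  show ?thesis
  proof (rule involved_inI[where N = N and \<rho> = "\<lambda>(f, x). \<rho> ix (supp f) (ix x)"])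
    show "group ?W" by (intro group_regular_wreath_product group_integer_mod_group H)
  next
    fix y assume "y \<in> carrier ?W"
    show "(\<lambda>(f, x). \<rho> ix (supp f) (ix x)) y \<in> carrier U"
      using U.m_closed[OF P_U h_U] by (cases y) (simp add: \<rho>_def U(3))
    show "y = \<one>\<^bsub>?W\<^esub>" if ker: "(\<lambda>(f, x). \<rho> ix (supp f) (ix x)) y \<in> N"
    proof -
      obtain f x where y: "y = (f, x)" "f \<in> carrier H \<rightarrow>\<^sub>E {0..<2}" "x \<in> carrier H"
        using \<open>y \<in> carrier ?W\<close>
        by (cases y) (auto simp: carrier_regular_wreath_product carrier_integer_mod_group)
      have "ix ` supp f \<subseteq> {..<2 ^ k}" using ix_less supp(1) by auto
      then have *: "supp f = {} \<and> ix x = 0"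
        using \<rho>_kernel[OF inj[OF supp(1)] _ ix_less] ker y by simp
      then have "x = \<one>\<^bsub>H\<^esub>"
        using inj_onD[OF inj[OF order_refl], of x "\<one>\<^bsub>H\<^esub>"] ix_one y by simp
      moreover have "f = (\<lambda>x\<in>carrier H. 0)"
      proof (rule extensionalityI[of _ "carrier H"])
        fix u assume u: "u \<in> carrier H"
        then have "f u \<in> {0..<2}" "f u \<noteq> 1" using y(2) * by (auto simp: supp_def)
        then show "f u = (\<lambda>x\<in>carrier H. 0) u" using u by auto
      qed (use y in \<open>auto simp: PiE_iff\<close>)
      ultimately show ?thesis using y by (simp add: one_regular_wreath_product)
    qed
    show "(\<lambda>(f, x). \<rho> ix (supp f) (ix x)) y \<otimes>\<^bsub>U\<^esub> n = n \<otimes>\<^bsub>U\<^esub> (\<lambda>(f, x). \<rho> ix (supp f) (ix x)) y"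
      if "n \<in> N" for n
      using that by (cases y) (simp add: U(3) \<rho>_commute)
  next
    fix y z assume "y \<in> carrier ?W" "z \<in> carrier ?W"
    then obtain f x g x' where y: "y = (f, x)" "f \<in> carrier H \<rightarrow>\<^sub>E {0..<2}" "x \<in> carrier H"
      and z: "z = (g, x')" "g \<in> carrier H \<rightarrow>\<^sub>E {0..<2}" "x' \<in> carrier H"
      by (cases y; cases z) (auto simp: carrier_regular_wreath_product carrier_integer_mod_group)
    \<comment> \<open>Composition with left multiplication by \<open>x^-1\<close>, as in the wreath
      product, moves the support of \<open>g\<close> by \<open>x\<close>; on exponents this is
      multiplication by \<open>L^(ix x)\<close>.\<close>
    define T where "T = (\<lambda>u. x \<otimes>\<^bsub>H\<^esub> u) ` supp g"
    have T: "T \<subseteq> carrier H" "finite T" using supp y by (auto simp: T_def)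
    have inj_x: "inj_on (\<lambda>u. x \<otimes>\<^bsub>H\<^esub> u) (supp g)"
      using H.inj_on_cmult[OF y(3)] supp(1) by (rule inj_on_subset)
    have "P ix T = (\<Oplus>u\<in>supp g. L [^] ix (x \<otimes>\<^bsub>H\<^esub> u))"
      unfolding P_def T_def using inj_x by (subst finsum_reindex) auto
    also have "\<dots> = (\<Oplus>u\<in>supp g. L [^] ix x \<otimes> L [^] ix u)"
      using subsetD[OF supp(1)] y by (intro finsum_cong') (auto simp: ix_mult L_pow_mod nat_pow_mult)
    also have "\<dots> = L [^] ix x \<otimes> P ix (supp g)"
      unfolding P_def using supp(2) by (subst finsum_rdistr) auto
    finally have PT: "P ix T = L [^] ix x \<otimes> P ix (supp g)" .
    define q where "q = (\<lambda>u\<in>carrier H. (f u + g (inv\<^bsub>H\<^esub> x \<otimes>\<^bsub>H\<^esub> u)) mod 2)"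
    have yz: "y \<otimes>\<^bsub>?W\<^esub> z = (q, x \<otimes>\<^bsub>H\<^esub> x')"
      using y z by (auto simp: mult_regular_wreath_product q_def intro!: restrict_ext)
    have "supp q = sym_diff (supp f) T"
    proof -
      have Tiff: "u \<in> T \<longleftrightarrow> g (inv\<^bsub>H\<^esub> x \<otimes>\<^bsub>H\<^esub> u) = 1" if u: "u \<in> carrier H" for u
      proof
        assume "u \<in> T"
        then show "g (inv\<^bsub>H\<^esub> x \<otimes>\<^bsub>H\<^esub> u) = 1"
          using y by (auto simp: T_def supp_def H.m_assoc[symmetric])
      next
        assume "g (inv\<^bsub>H\<^esub> x \<otimes>\<^bsub>H\<^esub> u) = 1"
        then have "inv\<^bsub>H\<^esub> x \<otimes>\<^bsub>H\<^esub> u \<in> supp g" using y u by (simp add: supp_def)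
        moreover have "u = x \<otimes>\<^bsub>H\<^esub> (inv\<^bsub>H\<^esub> x \<otimes>\<^bsub>H\<^esub> u)" using y u by (simp add: H.m_assoc[symmetric])
        ultimately show "u \<in> T" unfolding T_def by blast
      qed
      have "(a + b) mod 2 = 1 \<longleftrightarrow> (a = 1) \<noteq> (b = 1)" if "a \<in> {0..<2}" "b \<in> {0..<2}" for a b :: int
      proof -
        have "a = 0 \<or> a = 1" "b = 0 \<or> b = 1" using that by auto
        then show ?thesis by auto
      qed
      moreover have "f u \<in> {0..<2}" "g (inv\<^bsub>H\<^esub> x \<otimes>\<^bsub>H\<^esub> u) \<in> {0..<2}" if "u \<in> carrier H" for u
        using PiE_mem[OF y(2) that] PiE_mem[OF z(2), of "inv\<^bsub>H\<^esub> x \<otimes>\<^bsub>H\<^esub> u"] y(3) that by auto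
      ultimately have "u \<in> supp q \<longleftrightarrow> u \<in> sym_diff (supp f) T" if "u \<in> carrier H" for u
        using that Tiff by (auto simp: q_def supp_def)
      then show ?thesis using supp(1) T(1) by blast
    qed
    then show "\<exists>n\<in>N. (\<lambda>(f, x). \<rho> ix (supp f) (ix x)) y \<otimes>\<^bsub>U\<^esub> (\<lambda>(f, x). \<rho> ix (supp f) (ix x)) z =
        n \<otimes>\<^bsub>U\<^esub> (\<lambda>(f, x). \<rho> ix (supp f) (ix x)) (y \<otimes>\<^bsub>?W\<^esub> z)"
      unfolding yz using \<rho>_mult[OF supp(2) supp(2) PT T(2), of f "ix x'"] y z
      by (simp add: U(3) ix_mult)
  qed (use N U(1) in auto)
qed

end

section \<open>Constructing the data \<open>c\<close>, \<open>t\<close>, \<open>s\<close>,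
  \<open>w\<close> from generators\<close>

text \<open>\<open>A\<close>, \<open>B\<close>, \<open>d\<close> stand for \<open>a\<close>,
  \<open>b\<close>, \<open>b a b^-1\<close>. Everything follows from
  \<open>c A c = s c + w d\<close>, where \<open>w = c c\<close>: since \<open>w s = 0\<close>,
  \<open>w d = w A = c t\<close>, which is the relation for \<open>t c\<close>; multiplying by
  \<open>A\<close> and using \<open>w d A = w\<close> gives the one for \<open>t t\<close>.\<close>

lemma (in char2_ring) wreath_section_intro:
  fixes A B d \<theta> :: 'a and k :: nat
  defines "s \<equiv> A \<oplus> d" and "w \<equiv> \<one> \<oplus> \<theta> \<otimes> \<theta> \<otimes> (B \<otimes> B)" and "c \<equiv> \<one> \<oplus> \<theta> \<otimes> B"
  assumes closed [simp]: "A \<in> carrier R" "B \<in> carrier R" "d \<in> carrier R" "\<theta> \<in> carrier R"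
    and comm: "A \<otimes> d = d \<otimes> A" "B \<otimes> A = d \<otimes> B" "B \<otimes> d = A \<otimes> B"
      "A \<otimes> \<theta> = \<theta> \<otimes> A" "d \<otimes> \<theta> = \<theta> \<otimes> d" "B \<otimes> \<theta> = \<theta> \<otimes> B"
    and k: "k > 0" and sw: "s \<otimes> w = \<zero>" and Aw: "A \<otimes> w = w \<otimes> A" and wdA: "w \<otimes> (d \<otimes> A) = w"
    and ww: "w \<otimes> w = \<zero>"
    and s_pow: "s [^] (2 ^ k :: nat) = \<zero>"
    and nonvanishing: "s [^] (2 ^ k - 1 :: nat) \<otimes> c \<notin>
      {\<zero>, w, s [^] (2 ^ k - 1 :: nat) \<otimes> (c \<otimes> A), w \<oplus> s [^] (2 ^ k - 1 :: nat) \<otimes> (c \<otimes> A)}"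
  shows "wreath_section R c (c \<otimes> A) s w k"
proof -
  have [simp]: "s \<in> carrier R" "w \<in> carrier R" "c \<in> carrier R"
    by (simp_all add: s_def w_def c_def)
  have lcomm: "A \<otimes> (d \<otimes> x) = d \<otimes> (A \<otimes> x)" "B \<otimes> (A \<otimes> x) = d \<otimes> (B \<otimes> x)"
    "B \<otimes> (d \<otimes> x) = A \<otimes> (B \<otimes> x)" "A \<otimes> (\<theta> \<otimes> x) = \<theta> \<otimes> (A \<otimes> x)"
    "d \<otimes> (\<theta> \<otimes> x) = \<theta> \<otimes> (d \<otimes> x)" "B \<otimes> (\<theta> \<otimes> x) = \<theta> \<otimes> (B \<otimes> x)" if "x \<in> carrier R" for x
    using that by (simp_all add: comm flip: m_assoc)
  note normal = comm lcomm l_distr r_distr m_assoc a_ac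
  have cs: "c \<otimes> s = s \<otimes> c" and As: "A \<otimes> s = s \<otimes> A"
    by (simp_all add: c_def s_def normal)
  have cc: "c \<otimes> c = w"
    by (simp add: c_def w_def normal)
  have cAc: "c \<otimes> (A \<otimes> c) = s \<otimes> c \<oplus> w \<otimes> d"
    by (simp add: c_def w_def s_def normal)
  have ws: "w \<otimes> s = \<zero>"
    using sw by (simp add: w_def s_def normal)
  have wA: "w \<otimes> d = w \<otimes> A"
    using ws by (simp add: s_def r_distr add_eq_zero_iff)
  have cw: "c \<otimes> w = w \<otimes> c"
    by (simp add: cc[symmetric] m_assoc)
  show ?thesis
  proof unfold_locales
    show "c \<otimes> A \<otimes> s = s \<otimes> (c \<otimes> A)"
      by (simp add: m_assoc As) (simp add: cs flip: m_assoc)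
    have "c \<otimes> A \<otimes> (c \<otimes> A) = (c \<otimes> (A \<otimes> c)) \<otimes> A" by (simp add: m_assoc)
    then show "c \<otimes> A \<otimes> (c \<otimes> A) = s \<otimes> (c \<otimes> A) \<oplus> w"
      by (simp add: cAc l_distr m_assoc wdA)
    show "c \<otimes> A \<otimes> w = w \<otimes> (c \<otimes> A)"
      by (simp add: m_assoc Aw) (simp add: cw flip: m_assoc)
    have "c \<otimes> (c \<otimes> A) = w \<otimes> A" by (simp add: cc flip: m_assoc)
    then show "c \<otimes> A \<otimes> c = s \<otimes> c \<oplus> c \<otimes> (c \<otimes> A)" "s \<otimes> (c \<otimes> (c \<otimes> A)) = \<zero>"
      by (simp_all add: m_assoc cAc wA) (simp add: sw flip: m_assoc)
  qed (use assms cs cc ws in auto)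
qed

text \<open>All binomial coefficients of \<open>2^k - 1\<close> are odd. In the induction the upper
  half of the sum is a power of \<open>x\<close> times the lower half, and Frobenius turns the
  resulting factor into a power of \<open>1 + x\<close>.\<close>

lemma (in char2_ring) one_plus_pow_pred:
  assumes "x \<in> carrier R"
  shows "(\<one> \<oplus> x) [^] (2 ^ k - 1 :: nat) = (\<Oplus>j\<in>{..<2 ^ k}. x [^] (j::nat))"
proof (induction k)
  case (Suc k)
  let ?q = "2 ^ k :: nat"
  have exp: "2 ^ Suc k - 1 = ?q + (?q - 1)" by simp
  have split: "{..<2 ^ Suc k} = {..<?q} \<union> (\<lambda>j. ?q + j) ` {..<?q}"
  proof -
    have "i \<in> (\<lambda>j. ?q + j) ` {..<?q}" if "\<not> i < ?q" "i < 2 * ?q" for i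
      using that by (intro image_eqI[of _ _ "i - ?q"]) auto
    then show ?thesis by (auto simp only: power_Suc)
  qed
  have "(\<Oplus>j\<in>{..<2 ^ Suc k}. x [^] (j::nat)) =
      (\<Oplus>j\<in>{..<?q}. x [^] j) \<oplus> (\<Oplus>j\<in>(\<lambda>j. ?q + j) ` {..<?q}. x [^] j)"
    unfolding split using assms by (intro finsum_Un_disjoint) auto
  also have "(\<Oplus>j\<in>(\<lambda>j. ?q + j) ` {..<?q}. x [^] j) = x [^] ?q \<otimes> (\<Oplus>j\<in>{..<?q}. x [^] j)"
    using assms by (subst finsum_reindex) (auto simp: finsum_rdistr nat_pow_mult Pi_def)
  also have "(\<Oplus>j\<in>{..<?q}. x [^] j) \<oplus> x [^] ?q \<otimes> (\<Oplus>j\<in>{..<?q}. x [^] j) =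
      (\<one> \<oplus> x [^] ?q) \<otimes> (\<Oplus>j\<in>{..<?q}. x [^] j)"
    using assms by (simp add: l_distr Pi_def)
  also have "\<one> \<oplus> x [^] ?q = (\<one> \<oplus> x) [^] ?q"
    using frobenius_add[of "\<one>" x k] assms by simp
  finally have sum: "(\<Oplus>j\<in>{..<2 ^ Suc k}. x [^] (j::nat)) = (\<one> \<oplus> x) [^] ?q \<otimes> (\<Oplus>j\<in>{..<?q}. x [^] j)" .
  have "(\<one> \<oplus> x) [^] (?q + (?q - 1)) = (\<one> \<oplus> x) [^] ?q \<otimes> (\<one> \<oplus> x) [^] (?q - 1)"
    using assms by (intro nat_pow_mult[symmetric]) auto
  then show ?case unfolding exp sum Suc .
qed (use assms in \<open>simp add: lessThan_Suc\<close>)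

text \<open>
  The element \<open>\<theta>\<close> approximates a square root of the central involution \<open>A ^ 2 ^ (j + 1)\<close> by an
  element that, unlike \<open>A ^ 2 ^ j\<close>, commutes with \<open>B\<close>. Starting from \<open>\<theta> = 1\<close>, it is built by
  \<open>\<theta> \<mapsto> \<theta>\<^sup>2 + s ^ (2 ^ (j + 1) - 1)\<close>.
\<close>

lemma (in char2_ring) two_power_root_expansion:
  fixes A B d \<sigma> :: 'a
  defines "s \<equiv> A \<oplus> d"
  assumes closed [simp]: "A \<in> carrier R" "B \<in> carrier R" "d \<in> carrier R" "\<sigma> \<in> carrier R"
    and comm: "A \<otimes> d = \<one>" "d \<otimes> A = \<one>" "B \<otimes> A = d \<otimes> B" "B \<otimes> d = A \<otimes> B" and \<sigma>s: "\<sigma> \<otimes> s = \<zero>"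
  shows "\<exists>\<theta>\<in>carrier R. A \<otimes> \<theta> = \<theta> \<otimes> A \<and> d \<otimes> \<theta> = \<theta> \<otimes> d \<and> B \<otimes> \<theta> = \<theta> \<otimes> B \<and> \<sigma> \<otimes> \<theta> = \<sigma> \<and>
    A [^] (2 ^ Suc j :: nat) = \<theta> \<otimes> \<theta> \<oplus> s [^] (2 ^ Suc j - 1 :: nat) \<otimes> A"
proof -
  have [simp]: "s \<in> carrier R" by (simp add: s_def)
  have As: "A \<otimes> s = s \<otimes> A" and Bs: "B \<otimes> s = s \<otimes> B" and ds: "d \<otimes> s = s \<otimes> d"
    by (simp_all add: s_def l_distr r_distr comm a_ac)
  have commute: "A \<otimes> s [^] n = s [^] n \<otimes> A" "d \<otimes> s [^] n = s [^] n \<otimes> d" "B \<otimes> s [^] n = s [^] n \<otimes> B" for n :: nat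
    using As Bs ds closed \<open>s \<in> carrier R\<close> by (metis group_commutes_pow)+
  \<comment> \<open>As \<open>A d = 1\<close>, \<open>s A\<close> equals \<open>(1 + A)^2\<close>.
    Squaring \<open>q (1 + A)\<close> therefore gives \<open>q^2 s A\<close>, and for
    \<open>q = s^(2^j - 1)\<close> the new exponent is
    \<open>2 (2^j - 1) + 1 = 2^(j+1) - 1\<close>.\<close>
  have sA: "s \<otimes> A = \<one> \<oplus> A \<otimes> A" by (simp add: s_def l_distr comm a_ac)
  have square: "A [^] (2 ^ Suc j :: nat) = \<theta> \<otimes> \<theta> \<oplus> s [^] (2 ^ Suc j - 1 :: nat) \<otimes> A"
    if "\<theta> \<in> carrier R" "A \<otimes> \<theta> = \<theta> \<otimes> A" "d \<otimes> \<theta> = \<theta> \<otimes> d"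
      "A [^] (2 ^ j :: nat) = \<theta> \<oplus> s [^] (2 ^ j - 1 :: nat) \<otimes> (\<one> \<oplus> A)" for \<theta> j
  proof -
    let ?q = "s [^] (2 ^ j - 1 :: nat)"
    have "\<theta> \<otimes> s = s \<otimes> \<theta>" using that by (simp add: s_def l_distr r_distr)
    then have \<theta>q: "\<theta> \<otimes> ?q = ?q \<otimes> \<theta>"
      using that by (metis group_commutes_pow \<open>s \<in> carrier R\<close>)
    have "\<theta> \<otimes> (?q \<otimes> (\<one> \<oplus> A)) = (\<theta> \<otimes> ?q) \<otimes> (\<one> \<oplus> A)" using that by (simp add: m_assoc)
    also have "\<dots> = ?q \<otimes> ((\<one> \<oplus> A) \<otimes> \<theta>)"
      unfolding \<theta>q using that(1,2) by (simp add: m_assoc l_distr r_distr)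
    finally have c: "\<theta> \<otimes> (?q \<otimes> (\<one> \<oplus> A)) = ?q \<otimes> (\<one> \<oplus> A) \<otimes> \<theta>"
      using that by (simp add: m_assoc)
    have "A \<otimes> (?q \<otimes> A) = ?q \<otimes> (A \<otimes> A)"
      by (simp add: commute flip: m_assoc)
    then have "(\<one> \<oplus> A) \<otimes> (?q \<otimes> (\<one> \<oplus> A)) = ?q \<otimes> ((\<one> \<oplus> A) \<otimes> (\<one> \<oplus> A))"
      by (simp add: l_distr r_distr commute a_ac)
    also have "(\<one> \<oplus> A) \<otimes> (\<one> \<oplus> A) = s \<otimes> A"
      by (simp add: square_add sA)
    finally have "?q \<otimes> (\<one> \<oplus> A) \<otimes> (?q \<otimes> (\<one> \<oplus> A)) = ?q \<otimes> ?q \<otimes> s \<otimes> A"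
      by (simp add: m_assoc)
    also have "?q \<otimes> ?q \<otimes> s = s [^] (2 ^ Suc j - 1 :: nat)"
    proof -
      have "(1::nat) \<le> 2 ^ j" by simp
      then have "Suc ((2 ^ j - 1) + (2 ^ j - 1)) = 2 ^ Suc j - (1::nat)" by (simp only: power_Suc)
      then show ?thesis
        using nat_pow_mult[of s "2 ^ j - 1" "2 ^ j - 1"] nat_pow_Suc[of s "(2 ^ j - 1) + (2 ^ j - 1)"] by simp
    qed
    finally show ?thesis
      using that c by (simp add: nat_pow_double square_add)
  qed
  \<comment> \<open>The invariant carries \<open>1 + A\<close> where the goal has \<open>A\<close>.
    Squaring yields \<open>\<theta>^2 + p A\<close> with \<open>p\<close> the new power of
    \<open>s\<close>, and adding \<open>p\<close> twice rewrites this as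
    \<open>(\<theta>^2 + p) + p (1 + A)\<close>. At \<open>j = 0\<close> it reads
    \<open>A = 1 + (1 + A)\<close>.\<close>
  have "\<exists>\<theta>\<in>carrier R. A \<otimes> \<theta> = \<theta> \<otimes> A \<and> d \<otimes> \<theta> = \<theta> \<otimes> d \<and> B \<otimes> \<theta> = \<theta> \<otimes> B \<and> \<sigma> \<otimes> \<theta> = \<sigma> \<and>
    A [^] (2 ^ j :: nat) = \<theta> \<oplus> s [^] (2 ^ j - 1 :: nat) \<otimes> (\<one> \<oplus> A)"
  proof (induction j)
    case 0
    show ?case by (intro bexI[of _ "\<one>"]) auto
  next
    case (Suc j)
    then obtain \<theta> where \<theta>: "\<theta> \<in> carrier R" "A \<otimes> \<theta> = \<theta> \<otimes> A" "d \<otimes> \<theta> = \<theta> \<otimes> d" "B \<otimes> \<theta> = \<theta> \<otimes> B"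
      "\<sigma> \<otimes> \<theta> = \<sigma>" "A [^] (2 ^ j :: nat) = \<theta> \<oplus> s [^] (2 ^ j - 1 :: nat) \<otimes> (\<one> \<oplus> A)" by blast
    let ?p = "s [^] (2 ^ Suc j - 1 :: nat)"
    \<comment> \<open>The exponent is positive, so \<open>\<sigma> s = 0\<close> makes
      \<open>\<sigma>\<close> kill the correction; this preserves
      \<open>\<sigma> \<theta> = \<sigma>\<close>.\<close>
    define i where "i = 2 ^ Suc j - (2::nat)"
    have "(1::nat) \<le> 2 ^ j" by simp
    then have i: "2 ^ Suc j - 1 = Suc i" unfolding i_def by (simp only: power_Suc)
    have "\<sigma> \<otimes> ?p = (\<sigma> \<otimes> s) \<otimes> s [^] i"
      unfolding i by (simp only: nat_pow_Suc2 m_assoc closed \<open>s \<in> carrier R\<close> nat_pow_closed)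
    then have \<sigma>p: "\<sigma> \<otimes> ?p = \<zero>" by (simp add: \<sigma>s)
    have c: "x \<otimes> (\<theta> \<otimes> \<theta> \<oplus> ?p) = (\<theta> \<otimes> \<theta> \<oplus> ?p) \<otimes> x"
      if x: "x \<in> carrier R" "x \<otimes> \<theta> = \<theta> \<otimes> x" "x \<otimes> ?p = ?p \<otimes> x" for x
    proof -
      have "x \<otimes> (\<theta> \<otimes> \<theta>) = \<theta> \<otimes> \<theta> \<otimes> x"
        using x \<theta>(1) by (metis m_assoc)
      then show ?thesis using x \<theta> by (simp add: l_distr r_distr)
    qed
    have "\<sigma> \<otimes> (\<theta> \<otimes> \<theta> \<oplus> ?p) = \<sigma>"
      using \<theta> \<sigma>p by (simp add: r_distr del: One_nat_def flip: m_assoc)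
    moreover have "A [^] (2 ^ Suc j :: nat) = \<theta> \<otimes> \<theta> \<oplus> ?p \<oplus> ?p \<otimes> (\<one> \<oplus> A)"
      using square[OF \<theta>(1,2,3,6)] \<theta> by (simp add: r_distr a_ac)
    ultimately show ?case
      using c commute \<theta> by (intro bexI[of _ "\<theta> \<otimes> \<theta> \<oplus> ?p"]) (auto simp del: One_nat_def)
  qed
  then show ?thesis using square by blast
qed

section \<open>Group algebras of finite groups\<close>

locale finite_group_algebra = K: field K + G: group G
  for K :: "('k, 'm) ring_scheme" and G :: "('g, 'n) monoid_scheme" +
  assumes finite_carrier: "finite (carrier G)"
begin

abbreviation KG where "KG \<equiv> group_algebra K G"

lemma KG_carrier: "carrier KG = carrier G \<rightarrow>\<^sub>E carrier K"
  and KG_zero: "\<zero>\<^bsub>KG\<^esub> = (\<lambda>x\<in>carrier G. \<zero>\<^bsub>K\<^esub>)"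
  and KG_one: "\<one>\<^bsub>KG\<^esub> = (\<lambda>x\<in>carrier G. if x = \<one>\<^bsub>G\<^esub> then \<one>\<^bsub>K\<^esub> else \<zero>\<^bsub>K\<^esub>)"
  and KG_add: "f \<oplus>\<^bsub>KG\<^esub> g = (\<lambda>x\<in>carrier G. f x \<oplus>\<^bsub>K\<^esub> g x)"
  and KG_mult: "f \<otimes>\<^bsub>KG\<^esub> g =
    (\<lambda>x\<in>carrier G. \<Oplus>\<^bsub>K\<^esub>y\<in>carrier G. f y \<otimes>\<^bsub>K\<^esub> g (inv\<^bsub>G\<^esub> y \<otimes>\<^bsub>G\<^esub> x))"
  by (simp_all add: group_algebra_def)

lemma KG_coeff [simp]: "f \<in> carrier KG \<Longrightarrow> x \<in> carrier G \<Longrightarrow> f x \<in> carrier K"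
  by (auto simp: KG_carrier)

lemma KG_eqI:
  assumes "f \<in> carrier KG" "g \<in> carrier KG" "\<And>x. x \<in> carrier G \<Longrightarrow> f x = g x"
  shows "f = g"
  using assms unfolding KG_carrier by (rule PiE_ext)

lemma K_finsum_swap:
  assumes "finite A" "finite B" "\<And>x y. x \<in> A \<Longrightarrow> y \<in> B \<Longrightarrow> f x y \<in> carrier K"
  shows "(\<Oplus>\<^bsub>K\<^esub>x\<in>A. \<Oplus>\<^bsub>K\<^esub>y\<in>B. f x y) = (\<Oplus>\<^bsub>K\<^esub>y\<in>B. \<Oplus>\<^bsub>K\<^esub>x\<in>A. f x y)"
  using assms(1,3)
proof (induction A)
  case (insert a A)
  have "(\<Oplus>\<^bsub>K\<^esub>x\<in>insert a A. \<Oplus>\<^bsub>K\<^esub>y\<in>B. f x y) =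
      (\<Oplus>\<^bsub>K\<^esub>y\<in>B. f a y) \<oplus>\<^bsub>K\<^esub> (\<Oplus>\<^bsub>K\<^esub>y\<in>B. \<Oplus>\<^bsub>K\<^esub>x\<in>A. f x y)"
    using insert by (subst K.finsum_insert) (auto simp: Pi_def)
  also have "\<dots> = (\<Oplus>\<^bsub>K\<^esub>y\<in>B. f a y \<oplus>\<^bsub>K\<^esub> (\<Oplus>\<^bsub>K\<^esub>x\<in>A. f x y))"
    using insert.prems by (subst K.finsum_addf) (auto simp: Pi_def)
  also have "\<dots> = (\<Oplus>\<^bsub>K\<^esub>y\<in>B. \<Oplus>\<^bsub>K\<^esub>x\<in>insert a A. f x y)"
    using insert by (intro K.finsum_cong') (auto simp: Pi_def)
  finally show ?case .
qed simp

lemma K_finsum_shift: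
  assumes "f \<in> carrier G \<rightarrow> carrier K" "g \<in> carrier G"
  shows "(\<Oplus>\<^bsub>K\<^esub>x\<in>carrier G. f (g \<otimes>\<^bsub>G\<^esub> x)) = (\<Oplus>\<^bsub>K\<^esub>x\<in>carrier G. f x)"
proof -
  have im: "(\<lambda>x. g \<otimes>\<^bsub>G\<^esub> x) ` carrier G = carrier G"
    using assms(2) by (intro G.surj_const_mult)
  have inj: "inj_on (\<lambda>x. g \<otimes>\<^bsub>G\<^esub> x) (carrier G)"
    using assms(2) by (rule G.inj_on_cmult)
  show ?thesis
    using K.finsum_reindex[of f "\<lambda>x. g \<otimes>\<^bsub>G\<^esub> x" "carrier G"] assms im inj by auto
qed

lemma KG_mult_closed [simp]:
  "f \<in> carrier KG \<Longrightarrow> g \<in> carrier KG \<Longrightarrow> f \<otimes>\<^bsub>KG\<^esub> g \<in> carrier KG"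
  by (auto simp: KG_mult KG_carrier PiE_iff intro!: K.finsum_closed)

lemma KG_mult_assoc:
  assumes fgh: "f \<in> carrier KG" "g \<in> carrier KG" "h \<in> carrier KG"
  shows "(f \<otimes>\<^bsub>KG\<^esub> g) \<otimes>\<^bsub>KG\<^esub> h = f \<otimes>\<^bsub>KG\<^esub> (g \<otimes>\<^bsub>KG\<^esub> h)"
proof (rule KG_eqI)
  fix x assume x: "x \<in> carrier G"
  let ?G = "carrier G"
  have "((f \<otimes>\<^bsub>KG\<^esub> g) \<otimes>\<^bsub>KG\<^esub> h) x =
      (\<Oplus>\<^bsub>K\<^esub>y\<in>?G. (\<Oplus>\<^bsub>K\<^esub>z\<in>?G. f z \<otimes>\<^bsub>K\<^esub> g (inv\<^bsub>G\<^esub> z \<otimes>\<^bsub>G\<^esub> y)) \<otimes>\<^bsub>K\<^esub> h (inv\<^bsub>G\<^esub> y \<otimes>\<^bsub>G\<^esub> x))"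
    using x fgh by (auto simp: KG_mult Pi_def intro!: K.finsum_cong' K.finsum_closed)
  also have "\<dots> = (\<Oplus>\<^bsub>K\<^esub>y\<in>?G. \<Oplus>\<^bsub>K\<^esub>z\<in>?G. f z \<otimes>\<^bsub>K\<^esub> (g (inv\<^bsub>G\<^esub> z \<otimes>\<^bsub>G\<^esub> y) \<otimes>\<^bsub>K\<^esub> h (inv\<^bsub>G\<^esub> y \<otimes>\<^bsub>G\<^esub> x)))"
    using x fgh finite_carrier
    by (intro K.finsum_cong') (auto simp: K.finsum_ldistr K.m_assoc Pi_def intro!: K.finsum_cong' K.finsum_closed)
  also have "\<dots> = (\<Oplus>\<^bsub>K\<^esub>z\<in>?G. \<Oplus>\<^bsub>K\<^esub>y\<in>?G. f z \<otimes>\<^bsub>K\<^esub> (g (inv\<^bsub>G\<^esub> z \<otimes>\<^bsub>G\<^esub> y) \<otimes>\<^bsub>K\<^esub> h (inv\<^bsub>G\<^esub> y \<otimes>\<^bsub>G\<^esub> x)))"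
    using x fgh finite_carrier by (intro K_finsum_swap) auto
  also have "\<dots> = (\<Oplus>\<^bsub>K\<^esub>z\<in>?G. f z \<otimes>\<^bsub>K\<^esub> (\<Oplus>\<^bsub>K\<^esub>y\<in>?G. g (inv\<^bsub>G\<^esub> z \<otimes>\<^bsub>G\<^esub> y) \<otimes>\<^bsub>K\<^esub> h (inv\<^bsub>G\<^esub> y \<otimes>\<^bsub>G\<^esub> x)))"
    using x fgh finite_carrier
    by (intro K.finsum_cong') (auto simp: K.finsum_rdistr Pi_def intro!: K.finsum_closed)
  also have "\<dots> = (\<Oplus>\<^bsub>K\<^esub>z\<in>?G. f z \<otimes>\<^bsub>K\<^esub> (g \<otimes>\<^bsub>KG\<^esub> h) (inv\<^bsub>G\<^esub> z \<otimes>\<^bsub>G\<^esub> x))"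
  proof (intro K.finsum_cong' refl)
    \<comment> \<open>Replacing \<open>y\<close> by \<open>z y\<close> permutes the group and turns
      the inner sum into the convolution of \<open>g\<close> and \<open>h\<close> at
      \<open>z^-1 x\<close>.\<close>
    fix z assume z: "z \<in> ?G"
    have "(\<Oplus>\<^bsub>K\<^esub>y\<in>?G. g (inv\<^bsub>G\<^esub> z \<otimes>\<^bsub>G\<^esub> y) \<otimes>\<^bsub>K\<^esub> h (inv\<^bsub>G\<^esub> y \<otimes>\<^bsub>G\<^esub> x)) =
        (\<Oplus>\<^bsub>K\<^esub>y\<in>?G. g (inv\<^bsub>G\<^esub> z \<otimes>\<^bsub>G\<^esub> (z \<otimes>\<^bsub>G\<^esub> y)) \<otimes>\<^bsub>K\<^esub> h (inv\<^bsub>G\<^esub> (z \<otimes>\<^bsub>G\<^esub> y) \<otimes>\<^bsub>G\<^esub> x))"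
      using x z fgh
      by (intro K_finsum_shift[of "\<lambda>y. g (inv\<^bsub>G\<^esub> z \<otimes>\<^bsub>G\<^esub> y) \<otimes>\<^bsub>K\<^esub> h (inv\<^bsub>G\<^esub> y \<otimes>\<^bsub>G\<^esub> x)", symmetric]) auto
    also have "\<dots> = (\<Oplus>\<^bsub>K\<^esub>y\<in>?G. g y \<otimes>\<^bsub>K\<^esub> h (inv\<^bsub>G\<^esub> y \<otimes>\<^bsub>G\<^esub> (inv\<^bsub>G\<^esub> z \<otimes>\<^bsub>G\<^esub> x)))"
      using x z fgh
      by (intro K.finsum_cong')
        (auto simp: G.m_assoc[symmetric] G.inv_mult_group Pi_def)
    finally show "f z \<otimes>\<^bsub>K\<^esub> (\<Oplus>\<^bsub>K\<^esub>y\<in>?G. g (inv\<^bsub>G\<^esub> z \<otimes>\<^bsub>G\<^esub> y) \<otimes>\<^bsub>K\<^esub> h (inv\<^bsub>G\<^esub> y \<otimes>\<^bsub>G\<^esub> x)) =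
        f z \<otimes>\<^bsub>K\<^esub> (g \<otimes>\<^bsub>KG\<^esub> h) (inv\<^bsub>G\<^esub> z \<otimes>\<^bsub>G\<^esub> x)"
      using x z by (simp add: KG_mult)
  qed (use x fgh in auto)
  also have "\<dots> = (f \<otimes>\<^bsub>KG\<^esub> (g \<otimes>\<^bsub>KG\<^esub> h)) x"
    using x by (simp add: KG_mult[of f])
  finally show "((f \<otimes>\<^bsub>KG\<^esub> g) \<otimes>\<^bsub>KG\<^esub> h) x = (f \<otimes>\<^bsub>KG\<^esub> (g \<otimes>\<^bsub>KG\<^esub> h)) x" .
qed (use fgh in auto)

definition basis :: "'g \<Rightarrow> 'g \<Rightarrow> 'k" where
  "basis g = (\<lambda>x\<in>carrier G. if x = g then \<one>\<^bsub>K\<^esub> else \<zero>\<^bsub>K\<^esub>)"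

lemma basis_closed [simp]: "basis g \<in> carrier KG"
  by (auto simp: basis_def KG_carrier)

lemma KG_one_basis: "\<one>\<^bsub>KG\<^esub> = basis \<one>\<^bsub>G\<^esub>"
  by (simp add: KG_one basis_def)

lemma basis_mult_left:
  assumes "f \<in> carrier KG" "g \<in> carrier G" "x \<in> carrier G"
  shows "(basis g \<otimes>\<^bsub>KG\<^esub> f) x = f (inv\<^bsub>G\<^esub> g \<otimes>\<^bsub>G\<^esub> x)"
proof -
  have "(basis g \<otimes>\<^bsub>KG\<^esub> f) x =
      (\<Oplus>\<^bsub>K\<^esub>y\<in>carrier G. if g = y then f (inv\<^bsub>G\<^esub> y \<otimes>\<^bsub>G\<^esub> x) else \<zero>\<^bsub>K\<^esub>)"
    using assms by (auto simp: KG_mult basis_def intro!: K.finsum_cong')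
  also have "\<dots> = f (inv\<^bsub>G\<^esub> g \<otimes>\<^bsub>G\<^esub> x)"
    using assms finite_carrier by (intro K.finsum_singleton) auto
  finally show ?thesis .
qed

lemma basis_mult_right:
  assumes "f \<in> carrier KG" "g \<in> carrier G" "x \<in> carrier G"
  shows "(f \<otimes>\<^bsub>KG\<^esub> basis g) x = f (x \<otimes>\<^bsub>G\<^esub> inv\<^bsub>G\<^esub> g)"
proof -
  have *: "inv\<^bsub>G\<^esub> y \<otimes>\<^bsub>G\<^esub> x = g \<longleftrightarrow> x \<otimes>\<^bsub>G\<^esub> inv\<^bsub>G\<^esub> g = y" if "y \<in> carrier G" for y
    using assms that by (metis G.inv_closed G.inv_solve_left' G.inv_solve_right G.inv_solve_right' G.inv_solve_left)
  have "(f \<otimes>\<^bsub>KG\<^esub> basis g) x =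
      (\<Oplus>\<^bsub>K\<^esub>y\<in>carrier G. if x \<otimes>\<^bsub>G\<^esub> inv\<^bsub>G\<^esub> g = y then f y else \<zero>\<^bsub>K\<^esub>)"
    using assms by (auto simp: KG_mult basis_def * intro!: K.finsum_cong')
  also have "\<dots> = f (x \<otimes>\<^bsub>G\<^esub> inv\<^bsub>G\<^esub> g)"
    using assms finite_carrier by (intro K.finsum_singleton) auto
  finally show ?thesis .
qed

lemma basis_mult:
  assumes "g \<in> carrier G" "h \<in> carrier G"
  shows "basis g \<otimes>\<^bsub>KG\<^esub> basis h = basis (g \<otimes>\<^bsub>G\<^esub> h)"
proof (rule KG_eqI)
  fix x assume x: "x \<in> carrier G"
  have "inv\<^bsub>G\<^esub> g \<otimes>\<^bsub>G\<^esub> x = h \<longleftrightarrow> x = g \<otimes>\<^bsub>G\<^esub> h"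
    using assms x by (metis G.inv_closed G.inv_solve_left)
  then show "(basis g \<otimes>\<^bsub>KG\<^esub> basis h) x = basis (g \<otimes>\<^bsub>G\<^esub> h) x"
    using assms x by (simp add: basis_mult_left) (simp add: basis_def)
qed (use assms in auto)

lemma ring_KG: "ring KG"
proof (rule ringI)
  show "abelian_group KG"
  proof (rule abelian_groupI)
    fix f assume f: "f \<in> carrier KG"
    show "\<exists>g\<in>carrier KG. g \<oplus>\<^bsub>KG\<^esub> f = \<zero>\<^bsub>KG\<^esub>"
      using f by (intro bexI[of _ "\<lambda>x\<in>carrier G. \<ominus>\<^bsub>K\<^esub> f x"])
        (auto simp: KG_add KG_zero KG_carrier K.l_neg PiE_iff intro!: restrict_ext)
  next
    fix f g assume fg: "f \<in> carrier KG" "g \<in> carrier KG"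
    show "f \<oplus>\<^bsub>KG\<^esub> g \<in> carrier KG" using fg by (auto simp: KG_add KG_carrier)
    show "f \<oplus>\<^bsub>KG\<^esub> g = g \<oplus>\<^bsub>KG\<^esub> f"
      using fg by (auto simp: KG_add K.a_comm intro!: restrict_ext)
  next
    fix f g h assume "f \<in> carrier KG" "g \<in> carrier KG" "h \<in> carrier KG"
    then show "f \<oplus>\<^bsub>KG\<^esub> g \<oplus>\<^bsub>KG\<^esub> h = f \<oplus>\<^bsub>KG\<^esub> (g \<oplus>\<^bsub>KG\<^esub> h)"
      by (auto simp: KG_add K.a_assoc intro!: restrict_ext)
  next
    fix f assume f: "f \<in> carrier KG"
    show "\<zero>\<^bsub>KG\<^esub> \<oplus>\<^bsub>KG\<^esub> f = f"
    proof (rule KG_eqI)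
      show "\<zero>\<^bsub>KG\<^esub> \<oplus>\<^bsub>KG\<^esub> f \<in> carrier KG" using f by (auto simp: KG_add KG_zero KG_carrier)
    qed (use f in \<open>auto simp: KG_add KG_zero\<close>)
  qed (auto simp: KG_zero KG_carrier)
  show "monoid KG"
  proof (rule monoidI)
    fix f assume f: "f \<in> carrier KG"
    show "\<one>\<^bsub>KG\<^esub> \<otimes>\<^bsub>KG\<^esub> f = f"
      using f by (intro KG_eqI) (auto simp: KG_one_basis basis_mult_left)
    show "f \<otimes>\<^bsub>KG\<^esub> \<one>\<^bsub>KG\<^esub> = f"
      using f by (intro KG_eqI) (auto simp: KG_one_basis basis_mult_right)
  qed (auto simp: KG_mult_assoc KG_one_basis)
next
  fix f g h assume fgh: "f \<in> carrier KG" "g \<in> carrier KG" "h \<in> carrier KG"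
  have add: "f \<oplus>\<^bsub>KG\<^esub> g \<in> carrier KG" if "f \<in> carrier KG" "g \<in> carrier KG" for f g
    using that by (auto simp: KG_add KG_carrier)
  show "(f \<oplus>\<^bsub>KG\<^esub> g) \<otimes>\<^bsub>KG\<^esub> h = f \<otimes>\<^bsub>KG\<^esub> h \<oplus>\<^bsub>KG\<^esub> g \<otimes>\<^bsub>KG\<^esub> h"
  proof (intro KG_eqI)
    fix x assume x: "x \<in> carrier G"
    have "((f \<oplus>\<^bsub>KG\<^esub> g) \<otimes>\<^bsub>KG\<^esub> h) x = (\<Oplus>\<^bsub>K\<^esub>y\<in>carrier G.
        f y \<otimes>\<^bsub>K\<^esub> h (inv\<^bsub>G\<^esub> y \<otimes>\<^bsub>G\<^esub> x) \<oplus>\<^bsub>K\<^esub> g y \<otimes>\<^bsub>K\<^esub> h (inv\<^bsub>G\<^esub> y \<otimes>\<^bsub>G\<^esub> x))"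
      using x fgh by (auto simp: KG_mult KG_add K.l_distr simp del: K.finsum_addf intro!: K.finsum_cong')
    also have "\<dots> = (f \<otimes>\<^bsub>KG\<^esub> h \<oplus>\<^bsub>KG\<^esub> g \<otimes>\<^bsub>KG\<^esub> h) x"
      using x fgh by (simp add: KG_mult KG_add K.finsum_addf Pi_def)
    finally show "((f \<oplus>\<^bsub>KG\<^esub> g) \<otimes>\<^bsub>KG\<^esub> h) x = (f \<otimes>\<^bsub>KG\<^esub> h \<oplus>\<^bsub>KG\<^esub> g \<otimes>\<^bsub>KG\<^esub> h) x" .
  qed (use fgh add in auto)
  show "h \<otimes>\<^bsub>KG\<^esub> (f \<oplus>\<^bsub>KG\<^esub> g) = h \<otimes>\<^bsub>KG\<^esub> f \<oplus>\<^bsub>KG\<^esub> h \<otimes>\<^bsub>KG\<^esub> g"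
  proof (intro KG_eqI)
    fix x assume x: "x \<in> carrier G"
    have "(h \<otimes>\<^bsub>KG\<^esub> (f \<oplus>\<^bsub>KG\<^esub> g)) x = (\<Oplus>\<^bsub>K\<^esub>y\<in>carrier G.
        h y \<otimes>\<^bsub>K\<^esub> f (inv\<^bsub>G\<^esub> y \<otimes>\<^bsub>G\<^esub> x) \<oplus>\<^bsub>K\<^esub> h y \<otimes>\<^bsub>K\<^esub> g (inv\<^bsub>G\<^esub> y \<otimes>\<^bsub>G\<^esub> x))"
      using x fgh by (auto simp: KG_mult KG_add K.r_distr simp del: K.finsum_addf intro!: K.finsum_cong')
    also have "\<dots> = (h \<otimes>\<^bsub>KG\<^esub> f \<oplus>\<^bsub>KG\<^esub> h \<otimes>\<^bsub>KG\<^esub> g) x"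
      using x fgh by (simp add: KG_mult KG_add K.finsum_addf Pi_def)
    finally show "(h \<otimes>\<^bsub>KG\<^esub> (f \<oplus>\<^bsub>KG\<^esub> g)) x = (h \<otimes>\<^bsub>KG\<^esub> f \<oplus>\<^bsub>KG\<^esub> h \<otimes>\<^bsub>KG\<^esub> g) x" .
  qed (use fgh add in auto)
qed

lemma augmentation_hom: "augmentation K G \<in> ring_hom KG K"
proof (rule ring_hom_memI)
  fix f g assume fg: "f \<in> carrier KG" "g \<in> carrier KG"
  let ?G = "carrier G"
  show "augmentation K G f \<in> carrier K"
    using fg by (simp add: augmentation_def Pi_def)
  show "augmentation K G (f \<oplus>\<^bsub>KG\<^esub> g) = augmentation K G f \<oplus>\<^bsub>K\<^esub> augmentation K G g"
  proof -
    have "augmentation K G (f \<oplus>\<^bsub>KG\<^esub> g) = (\<Oplus>\<^bsub>K\<^esub>x\<in>?G. f x \<oplus>\<^bsub>K\<^esub> g x)"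
      using fg unfolding augmentation_def by (intro K.finsum_cong') (auto simp: KG_add)
    then show ?thesis using fg by (simp add: augmentation_def K.finsum_addf Pi_def)
  qed
  have "augmentation K G (f \<otimes>\<^bsub>KG\<^esub> g) =
      (\<Oplus>\<^bsub>K\<^esub>x\<in>?G. \<Oplus>\<^bsub>K\<^esub>y\<in>?G. f y \<otimes>\<^bsub>K\<^esub> g (inv\<^bsub>G\<^esub> y \<otimes>\<^bsub>G\<^esub> x))"
    using fg unfolding augmentation_def by (intro K.finsum_cong') (auto simp: KG_mult intro!: K.finsum_closed)
  also have "\<dots> = (\<Oplus>\<^bsub>K\<^esub>y\<in>?G. \<Oplus>\<^bsub>K\<^esub>x\<in>?G. f y \<otimes>\<^bsub>K\<^esub> g (inv\<^bsub>G\<^esub> y \<otimes>\<^bsub>G\<^esub> x))"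
    using fg finite_carrier by (intro K_finsum_swap) auto
  also have "\<dots> = (\<Oplus>\<^bsub>K\<^esub>y\<in>?G. f y \<otimes>\<^bsub>K\<^esub> augmentation K G g)"
    using fg finite_carrier K_finsum_shift[of g] unfolding augmentation_def
    by (intro K.finsum_cong') (auto simp: K.finsum_rdistr[symmetric] Pi_def)
  also have "\<dots> = augmentation K G f \<otimes>\<^bsub>K\<^esub> augmentation K G g"
    using fg finite_carrier unfolding augmentation_def by (subst K.finsum_ldistr) (auto simp: Pi_def)
  finally show "augmentation K G (f \<otimes>\<^bsub>KG\<^esub> g) = augmentation K G f \<otimes>\<^bsub>K\<^esub> augmentation K G g" .
next
  have "augmentation K G \<one>\<^bsub>KG\<^esub> = (\<Oplus>\<^bsub>K\<^esub>x\<in>carrier G. if \<one>\<^bsub>G\<^esub> = x then \<one>\<^bsub>K\<^esub> else \<zero>\<^bsub>K\<^esub>)"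
    unfolding augmentation_def by (intro K.finsum_cong') (auto simp: KG_one)
  also have "\<dots> = \<one>\<^bsub>K\<^esub>"
    using finite_carrier by (intro K.finsum_singleton) auto
  finally show "augmentation K G \<one>\<^bsub>KG\<^esub> = \<one>\<^bsub>K\<^esub>" .
qed

end

section \<open>Groups of maximal class\<close>

text \<open>
  Here \<open>2 ^ k\<close> is the order of the commutator subgroup, and \<open>b a b\<^sup>-\<^sup>1 = a ^ r\<close> with \<open>r = -1\<close> or, in
  the semidihedral case, \<open>r = -1 + 2 ^ k\<close> modulo \<open>2 ^ (k + 1)\<close>.
\<close>

locale maximal_class_presentation = group +
  fixes a b :: 'a and k r :: nat
  assumes a [simp]: "a \<in> carrier G" and b [simp]: "b \<in> carrier G" and k: "k > 0"
    and order: "order G = 4 * 2 ^ k" and generate: "generate G {a, b} = carrier G"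
    and a_pow: "a [^] (2 * 2 ^ k :: nat) = \<one>"
    and b_square: "b \<otimes> b = \<one> \<or> b \<otimes> b = a [^] (2 ^ k :: nat) \<and> r = 2 * 2 ^ k - 1"
    and ba: "b \<otimes> a = a [^] r \<otimes> b"
    and r: "r = 2 * 2 ^ k - 1 \<or> r = 2 ^ k - 1 \<and> k \<ge> 2"
begin

definition m :: nat where "m = 2 ^ k"

lemma m_even: "even m" and m_ge_2: "m \<ge> 2"
  using k by (auto simp: m_def) (cases k; auto)

lemma r_odd: "odd r"
  using r k by auto

lemma a_pow_mod: "a [^] (i mod (2 * m)) = a [^] (i :: nat)"
proof -
  have "a [^] i = a [^] (2 * m * (i div (2 * m)) + i mod (2 * m))" by simp
  also have "\<dots> = a [^] (i mod (2 * m))"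
    by (subst nat_pow_mult[symmetric]) (simp_all add: nat_pow_pow[symmetric] a_pow m_def)
  finally show ?thesis by simp
qed

lemma a_pow_cong: "[i = j] (mod 2 * m) \<Longrightarrow> a [^] i = a [^] (j :: nat)"
  by (metis a_pow_mod cong_def)

lemma b_a_pow: "b \<otimes> a [^] (i::nat) = a [^] (r * i) \<otimes> b"
proof (induction i)
  case (Suc i)
  have "b \<otimes> a [^] Suc i = (b \<otimes> a [^] i) \<otimes> a" by (simp add: m_assoc)
  also have "\<dots> = a [^] (r * i) \<otimes> (b \<otimes> a)" by (simp add: Suc m_assoc)
  also have "\<dots> = (a [^] (r * i) \<otimes> a [^] r) \<otimes> b" by (simp add: ba m_assoc)
  also have "\<dots> = a [^] (r * Suc i) \<otimes> b" by (simp add: nat_pow_mult add.commute)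
  finally show ?case .
qed simp

lemma b_square_power: "\<exists>i::nat. b \<otimes> b = a [^] (m * i)"
  using b_square by (auto simp: m_def intro: exI[of _ 0] exI[of _ 1])

section \<open>Normal form \<open>a^i b^j\<close> and parity of the exponent of
  \<open>a\<close>\<close>

definition elt :: "nat \<Rightarrow> bool \<Rightarrow> 'a" where
  "elt i j = a [^] i \<otimes> (if j then b else \<one>)"

lemma elt_closed [simp]: "elt i j \<in> carrier G"
  by (simp add: elt_def)

text \<open>Moving \<open>b\<close> past a power of \<open>a\<close> multiplies the exponent by the
  odd number \<open>r\<close>, and \<open>b^2\<close> contributes a multiple of the even number
  \<open>m\<close>. So the parity of the exponent of \<open>a\<close> is additive, which later
  locates the commutators.\<close>

lemma elt_mult:
  "\<exists>l. elt i j \<otimes> elt i' j' = elt l (j \<noteq> j') \<and> (even l \<longleftrightarrow> even (i + i'))"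
proof -
  obtain z :: nat where z: "b \<otimes> b = a [^] (m * z)" using b_square_power by blast
  show ?thesis
  proof (cases j)
    case True
    have "elt i j \<otimes> elt i' j' = a [^] i \<otimes> (b \<otimes> a [^] i') \<otimes> (if j' then b else \<one>)"
      using True by (simp add: elt_def m_assoc)
    also have "\<dots> = a [^] (i + r * i') \<otimes> (b \<otimes> (if j' then b else \<one>))"
      by (simp add: b_a_pow m_assoc nat_pow_mult[symmetric])
    also have "\<dots> = elt (if j' then i + r * i' + m * z else i + r * i') (j \<noteq> j')"
      using True by (simp add: elt_def z nat_pow_mult)
    finally show ?thesis using r_odd m_even
      by (intro exI[of _ "if j' then i + r * i' + m * z else i + r * i'"]) simp
  next
    case False
    then have "elt i j \<otimes> elt i' j' = elt (i + i') (j \<noteq> j')"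
      by (simp add: elt_def nat_pow_mult flip: m_assoc)
    then show ?thesis by blast
  qed
qed

lemma inv_a_pow: "inv (a [^] (i::nat)) = a [^] ((2 * m - 1) * i)"
proof (rule inv_equality)
  have "(2 * m - 1) * i + i = 2 * m * i" using m_ge_2 by (simp add: algebra_simps)
  then have "a [^] ((2 * m - 1) * i) \<otimes> a [^] i = a [^] (2 * m * i)" by (simp add: nat_pow_mult)
  then show "a [^] ((2 * m - 1) * i) \<otimes> a [^] i = \<one>"
    using a_pow_cong[of "2 * m * i" 0] by (simp add: cong_def)
qed auto

lemma elt_inv: "\<exists>l. inv (elt i j) = elt l j \<and> (even l \<longleftrightarrow> even i)"
proof -
  obtain z :: nat where z: "b \<otimes> b = a [^] (m * z)" using b_square_power by blast
  have "a [^] (m * z) \<otimes> a [^] (m * z) = a [^] (2 * m * z)"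
    by (simp add: nat_pow_mult mult_2 distrib_right)
  also have "\<dots> = \<one>" using a_pow_cong[of "2 * m * z" 0] by (simp add: cong_def)
  finally have "a [^] (m * z) \<otimes> b \<otimes> b = \<one>" by (simp add: z m_assoc)
  then have inv_b: "inv b = a [^] (m * z) \<otimes> b" by (intro inv_equality) auto
  have inv_elt: "inv (elt i j) = elt (if j then m * z else 0) j \<otimes> elt ((2 * m - 1) * i) False"
    by (simp add: elt_def inv_mult_group inv_a_pow inv_b)
  obtain l where "inv (elt i j) = elt l j"
      "even l \<longleftrightarrow> even ((if j then m * z else 0) + (2 * m - 1) * i)"
    unfolding inv_elt using elt_mult[of "if j then m * z else 0" j "(2 * m - 1) * i" False] by auto
  moreover have "odd (2 * m - 1)" using m_ge_2 by simp
  ultimately show ?thesis using m_even by (auto split: if_splits)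
qed

lemma generators: "h \<in> {a, b} \<Longrightarrow> \<exists>i j. h = elt i j"
proof -
  have "a = elt 1 False" "b = elt 0 True" by (simp_all add: elt_def)
  then show "h \<in> {a, b} \<Longrightarrow> \<exists>i j. h = elt i j" by blast
qed

lemma elt_surj: "x \<in> carrier G \<Longrightarrow> \<exists>i j. x = elt i j"
  unfolding generate[symmetric]
proof (induction rule: generate.induct)
  case one
  show ?case by (intro exI[of _ 0] exI[of _ False]) (simp add: elt_def)
next
  case (incl h)
  then show ?case using generators by blast
next
  case (inv h)
  then obtain i j where "h = elt i j"
    using generators by blast
  then show ?case using elt_inv[of i j] by auto
next
  case (eng x y)
  then obtain i j i' j' where "x = elt i j" "y = elt i' j'" by blast
  then show ?case using elt_mult[of i j i' j'] by auto
qed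

lemma finite_G: "finite (carrier G)"
  by (simp add: order flip: order_gt_0_iff_finite)

lemma elt_mod: "elt (i mod (2 * m)) j = elt i j"
  by (simp add: elt_def a_pow_mod)

text \<open>The normal forms with \<open>i < 2 m\<close> exhaust the group, and there are
  \<open>4 m\<close> of them, which is its order; a surjection between finite sets of equal size is
  injective.\<close>

lemma elt_inj: "elt i j = elt i' j' \<longleftrightarrow> [i = i'] (mod 2 * m) \<and> j = j'"
proof -
  let ?A = "{..<2 * m} \<times> (UNIV :: bool set)"
  have "(\<lambda>(i, j). elt i j) ` ?A = carrier G"
  proof
    show "carrier G \<subseteq> (\<lambda>(i, j). elt i j) ` ?A"
    proof
      fix x assume "x \<in> carrier G"
      then obtain i j where "x = elt i j" using elt_surj by blast
      then have "x = (\<lambda>(i, j). elt i j) (i mod (2 * m), j)" by (simp add: elt_mod)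
      then show "x \<in> (\<lambda>(i, j). elt i j) ` ?A" using m_ge_2 by (intro image_eqI[of _ _ "(i mod (2 * m), j)"]) auto
    qed
  qed auto
  moreover have "card ?A = card (carrier G)"
    using order by (simp add: order_def m_def card_cartesian_product)
  ultimately have inj: "inj_on (\<lambda>(i, j). elt i j) ?A"
    by (intro eq_card_imp_inj_on) auto
  show ?thesis
  proof
    assume "elt i j = elt i' j'"
    then have "(\<lambda>(i, j). elt i j) (i mod (2 * m), j) = (\<lambda>(i, j). elt i j) (i' mod (2 * m), j')"
      by (simp add: elt_mod)
    then have "(i mod (2 * m), j) = (i' mod (2 * m), j')"
      using m_ge_2 by (intro inj_onD[OF inj]) auto
    then show "[i = i'] (mod 2 * m) \<and> j = j'" by (simp add: cong_def)
  next
    assume "[i = i'] (mod 2 * m) \<and> j = j'"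
    then show "elt i j = elt i' j'" using a_pow_cong by (simp add: elt_def)
  qed
qed

lemma a_pow_inj: "a [^] i = a [^] (i' :: nat) \<longleftrightarrow> [i = i'] (mod 2 * m)"
  using elt_inj[of i False i' False] by (simp add: elt_def)

lemma parity_cong: "[i = i'] (mod 2 * m) \<Longrightarrow> even i \<longleftrightarrow> even (i' :: nat)"
  by (metis cong_dvd_iff cong_dvd_modulus_nat dvd_triv_left)

text \<open>Respectively: conjugation by \<open>b\<close> is an involution on the powers of
  \<open>a\<close>, \<open>b\<close> centralizes \<open>a^m\<close>, and \<open>a^(r-1)\<close>
  generates the same subgroup as \<open>a^2\<close>. In the semidihedral case the half
  \<open>u\<close> is \<open>m/2 - 1\<close>, which is odd because \<open>k \<ge> 2\<close> makes
  \<open>m\<close> divisible by 4.\<close>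

lemma rr: "[r * r = 1] (mod 2 * m)" and rm: "[r * m = m] (mod 2 * m)"
  and half_r: "\<exists>u. r = 2 * u + 1 \<and> coprime u m"
proof -
  have add_multiple: "[x + n * y = x] (mod n)" for x y n :: nat by (simp add: cong_def)
  have *: "[r * r = 1] (mod 2 * m) \<and> [r * m = m] (mod 2 * m) \<and> (\<exists>u. r = 2 * u + 1 \<and> odd u)"
  proof (cases "r = 2 * m - 1")
    case True
    obtain n where n: "m = Suc (Suc n)" using m_ge_2 by (metis add_2_eq_Suc le_Suc_ex)
    have rr: "r * r = 1 + 2 * m * (2 * n + 2)" and rm: "r * m = m + 2 * m * Suc n"
      using True n by (auto simp: algebra_simps)
    have "[r * r = 1] (mod 2 * m)" "[r * m = m] (mod 2 * m)"
      unfolding rr rm by (rule add_multiple)+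
    moreover have "r = 2 * Suc n + 1" "odd (Suc n)" using True n m_even by auto
    ultimately show ?thesis by blast
  next
    case False
    then have "r = m - 1" "k \<ge> 2" using r by (auto simp: m_def)
    moreover obtain n where n: "m = 4 * Suc n"
    proof -
      have "2 ^ (k - 2) > (0::nat)" by simp
      then obtain n where "2 ^ (k - 2) = Suc n" using gr0_implies_Suc by blast
      moreover have "2 ^ (2 + (k - 2)) = (4::nat) * 2 ^ (k - 2)" by (subst power_add) simp
      then have "m = 4 * 2 ^ (k - 2)" using \<open>k \<ge> 2\<close> by (simp only: m_def le_add_diff_inverse)
      ultimately show ?thesis using that by simp
    qed
    ultimately have rr: "r * r = 1 + 2 * m * (2 * n + 1)" and rm: "r * m = m + 2 * m * (2 * n + 1)"
      by (auto simp: algebra_simps)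
    have "[r * r = 1] (mod 2 * m)" "[r * m = m] (mod 2 * m)"
      unfolding rr rm by (rule add_multiple)+
    moreover have "r = 2 * (2 * n + 1) + 1" "odd (2 * n + 1)" using \<open>r = m - 1\<close> n by auto
    ultimately show ?thesis by blast
  qed
  then show "[r * r = 1] (mod 2 * m)" "[r * m = m] (mod 2 * m)" by auto
  show "\<exists>u. r = 2 * u + 1 \<and> coprime u m"
    using * unfolding m_def by (auto simp: coprime_power_right_iff)
qed

text \<open>Half of \<open>r - 1\<close> is invertible modulo \<open>m\<close>, so its inverse times
  \<open>i\<close>, reduced modulo \<open>m\<close>, solves for \<open>j\<close>.\<close>

lemma even_pow_eq: "\<exists>j<m. a [^] (2 * i :: nat) = a [^] ((r - 1) * j)"
proof -
  obtain u where u: "r = 2 * u + 1" "coprime u m" using half_r by blast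
  then obtain x where x: "[u * x = 1] (mod m)" using cong_solve_coprime_nat by auto
  have "[u * (x * i mod m) = (u * x) * i] (mod m)"
    by (simp add: cong_def mod_mult_right_eq mult.assoc)
  also have "[(u * x) * i = 1 * i] (mod m)" using x by (rule cong_scalar_right)
  finally have "[2 * (u * (x * i mod m)) = 2 * i] (mod 2 * m)"
    unfolding cong_def mult_mod_right[symmetric] by simp
  then have "a [^] (2 * i) = a [^] ((r - 1) * (x * i mod m))"
    using u by (simp add: a_pow_cong mult.assoc cong_sym)
  then show ?thesis using m_ge_2 by (intro exI[of _ "x * i mod m"]) auto
qed

section \<open>The commutator subgroup\<close>

definition T where "T = range (\<lambda>i::nat. a [^] (2 * i))"

lemma T_subset: "T \<subseteq> carrier G" by (auto simp: T_def)

lemma T_iff: "elt i j \<in> T \<longleftrightarrow> even i \<and> \<not> j"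
proof
  assume "elt i j \<in> T"
  then obtain l where "elt i j = elt (2 * l) False" by (auto simp: T_def elt_def)
  then show "even i \<and> \<not> j" using parity_cong[of i "2 * l"] by (auto simp: elt_inj)
qed (auto simp: T_def elt_def)

text \<open>\<open>x y\<close> and \<open>y x\<close> have the same exponent of \<open>b\<close> and
  exponents of \<open>a\<close> of equal parity, so their quotient is an even power of
  \<open>a\<close>.\<close>

lemma commutator_in_T:
  assumes "x \<in> carrier G" "y \<in> carrier G"
  shows "x \<otimes> y \<otimes> inv x \<otimes> inv y \<in> T"
proof -
  obtain i j i' j' where xy: "x = elt i j" "y = elt i' j'" using elt_surj assms by metis
  obtain l where l: "x \<otimes> y = elt l (j \<noteq> j')" "even l \<longleftrightarrow> even (i + i')"
    using elt_mult xy by metis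
  obtain l' where l': "y \<otimes> x = elt l' (j \<noteq> j')" "even l' \<longleftrightarrow> even (i + i')"
  proof -
    obtain l0 where l0: "y \<otimes> x = elt l0 (j' \<noteq> j)" "even l0 \<longleftrightarrow> even (i' + i)"
      using elt_mult xy by metis
    have "(j' \<noteq> j) = (j \<noteq> j')" by auto
    with l0(1) have "y \<otimes> x = elt l0 (j \<noteq> j')" by (simp only:)
    then show ?thesis using that l0(2) by (simp add: add.commute)
  qed
  obtain l'' where l'': "inv (y \<otimes> x) = elt l'' (j \<noteq> j')" "even l'' \<longleftrightarrow> even l'"
    using elt_inv l' by metis
  have "x \<otimes> y \<otimes> inv x \<otimes> inv y = x \<otimes> y \<otimes> inv (y \<otimes> x)"
    using assms by (simp add: inv_mult_group m_assoc)
  moreover obtain q where "x \<otimes> y \<otimes> inv (y \<otimes> x) = elt q False" "even q \<longleftrightarrow> even (l + l'')"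
    using elt_mult[of l "j \<noteq> j'" l'' "j \<noteq> j'"] l l'' by auto
  ultimately show ?thesis using l l' l'' by (simp add: T_iff)
qed

lemma subgroup_T: "subgroup T G"
proof (rule subgroupI)
  fix x y assume "x \<in> T" "y \<in> T"
  then obtain i j :: nat where "x = a [^] (2 * i)" "y = a [^] (2 * j)" by (auto simp: T_def)
  then have "x \<otimes> y = a [^] (2 * (i + j))" by (simp add: nat_pow_mult)
  then show "x \<otimes> y \<in> T" unfolding T_def by blast
next
  fix x assume "x \<in> T"
  then obtain i :: nat where "x = a [^] (2 * i)" by (auto simp: T_def)
  then have "inv x = a [^] (2 * ((2 * m - 1) * i))" by (simp only: inv_a_pow mult.left_commute)
  then show "inv x \<in> T" unfolding T_def by blast
qed (use T_subset in \<open>auto simp: T_def\<close>)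

text \<open>The single commutator \<open>b a b^-1 a^-1 = a^(r-1)\<close> already generates all even
  powers of \<open>a\<close>, by \<open>even_pow_eq\<close>.\<close>

lemma derived_eq_T: "derived G (carrier G) = T"
proof
  show "derived G (carrier G) \<subseteq> T"
    unfolding derived_def using commutator_in_T by (intro generate_subgroup_incl subgroup_T) auto
  interpret D: subgroup "derived G (carrier G)" G by (rule derived_is_subgroup) simp
  have "b \<otimes> a \<otimes> inv b \<otimes> inv a \<in> derived G (carrier G)"
    unfolding derived_def by (rule generate.incl) (use a b in blast)
  also have "b \<otimes> a \<otimes> inv b \<otimes> inv a = a [^] (r - 1)"
  proof -
    have "r > 0" using r_odd by (rule odd_pos)
    then have "a [^] r = a [^] (r - 1) \<otimes> a" using nat_pow_Suc[of a "r - 1"] by simp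
    then show ?thesis by (simp add: ba m_assoc)
  qed
  finally have "(a [^] (r - 1)) [^] j \<in> derived G (carrier G)" for j :: nat
    by (induction j) auto
  then have D: "a [^] ((r - 1) * j) \<in> derived G (carrier G)" for j :: nat
    by (simp add: nat_pow_pow)
  show "T \<subseteq> derived G (carrier G)"
  proof
    fix x assume "x \<in> T"
    then obtain i :: nat where "x = a [^] (2 * i)" by (auto simp: T_def)
    then show "x \<in> derived G (carrier G)" using even_pow_eq[of i] D by auto
  qed
qed

lemma bij_betw_T: "bij_betw (\<lambda>i. a [^] (2 * i :: nat)) {..<m} T"
proof (rule bij_betw_imageI)
  show "inj_on (\<lambda>i. a [^] (2 * i :: nat)) {..<m}"
  proof (rule inj_onI)
    fix i j assume ij: "i \<in> {..<m}" "j \<in> {..<m}" and "a [^] (2 * i) = a [^] (2 * j)"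
    then have "[2 * i = 2 * j] (mod 2 * m)" by (simp only: a_pow_inj)
    then show "i = j" using ij cong_less_modulus_unique_nat[of "2 * i" "2 * j" "2 * m"] by simp
  qed
  show "(\<lambda>i. a [^] (2 * i :: nat)) ` {..<m} = T"
  proof
    show "T \<subseteq> (\<lambda>i. a [^] (2 * i :: nat)) ` {..<m}"
    proof
      fix x assume "x \<in> T"
      then obtain i :: nat where "x = a [^] (2 * i)" by (auto simp: T_def)
      moreover have "[2 * i = 2 * (i mod m)] (mod 2 * m)" unfolding cong_def mult_mod_right[symmetric] by simp
      ultimately have "x = a [^] (2 * (i mod m))" by (simp only: a_pow_cong)
      then show "x \<in> (\<lambda>i. a [^] (2 * i :: nat)) ` {..<m}"
        by (rule image_eqI) (use m_ge_2 in simp)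
    qed
  qed (auto simp: T_def)
qed

text \<open>This enumeration of \<open>T\<close> is the one in which the sum over \<open>T\<close>
  appears as a geometric sum when \<open>s^(m-1)\<close> is expanded.\<close>

lemma bij_betw_T': "bij_betw (\<lambda>j. a [^] ((r - 1) * j :: nat)) {..<m} T"
proof -
  obtain u where "r = 2 * u + 1" "coprime u m" using half_r by blast
  then have u: "r - 1 = 2 * u" by simp
  have im: "(\<lambda>j. a [^] ((r - 1) * j :: nat)) ` {..<m} = T"
  proof
    show "(\<lambda>j. a [^] ((r - 1) * j :: nat)) ` {..<m} \<subseteq> T"
      unfolding T_def u mult.assoc by blast
    show "T \<subseteq> (\<lambda>j. a [^] ((r - 1) * j :: nat)) ` {..<m}"
    proof
      fix x assume "x \<in> T"
      then obtain i :: nat where "x = a [^] (2 * i)" by (auto simp: T_def)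
      then show "x \<in> (\<lambda>j. a [^] ((r - 1) * j :: nat)) ` {..<m}" using even_pow_eq[of i] by auto
    qed
  qed
  have "card T = m" using bij_betw_same_card[OF bij_betw_T] by simp
  then show ?thesis
    using im eq_card_imp_inj_on[of "{..<m}" "\<lambda>j. a [^] ((r - 1) * j)"]
    by (simp add: bij_betw_def del: One_nat_def)
qed

end

section \<open>The group algebra of a group of maximal class\<close>

text \<open>The defining relations conjugate by \<open>b^-1\<close>, the locale by \<open>b\<close>.
  Both give the same power of \<open>a\<close>, because \<open>b^2\<close> is a power of
  \<open>a\<close> and hence commutes with \<open>a\<close>. The exponent \<open>k\<close> is
  \<open>n - 2\<close>.\<close>

lemma maximal_class_2_group_presentation:
  assumes "maximal_class_2_group G"
  obtains a b k r where "maximal_class_presentation G a b k r"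
proof -
  have *: "maximal_class_presentation G a b (n - 2) r"
    if G: "group G" "order G = 2 ^ n" and n: "n \<ge> 3" and ab: "a \<in> carrier G" "b \<in> carrier G"
      and gen: "generate G {a, b} = carrier G" and a: "a [^]\<^bsub>G\<^esub> (2 ^ (n - 1) :: nat) = \<one>\<^bsub>G\<^esub>"
      and b: "b [^]\<^bsub>G\<^esub> (2 :: nat) = \<one>\<^bsub>G\<^esub> \<or>
        b [^]\<^bsub>G\<^esub> (2 :: nat) = a [^]\<^bsub>G\<^esub> (2 ^ (n - 2) :: nat) \<and> r = 2 * 2 ^ (n - 2) - 1"
      and conj: "inv\<^bsub>G\<^esub> b \<otimes>\<^bsub>G\<^esub> a \<otimes>\<^bsub>G\<^esub> b = a [^]\<^bsub>G\<^esub> r"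
      and r: "r = 2 * 2 ^ (n - 2) - 1 \<or> r = 2 ^ (n - 2) - 1 \<and> n - 2 \<ge> 2"
    for a b n and r :: nat
  proof -
    interpret group G by fact
    obtain j where j: "n = 3 + j" using le_Suc_ex[OF n] by blast
    have bb: "b \<otimes>\<^bsub>G\<^esub> b = b [^]\<^bsub>G\<^esub> (2 :: nat)" using ab by (simp add: numeral_2_eq_2)
    have com: "a \<otimes>\<^bsub>G\<^esub> (b \<otimes>\<^bsub>G\<^esub> b) = (b \<otimes>\<^bsub>G\<^esub> b) \<otimes>\<^bsub>G\<^esub> a"
      using b ab unfolding bb by (auto simp: group_commutes_pow)
    have "a \<otimes>\<^bsub>G\<^esub> b = b \<otimes>\<^bsub>G\<^esub> a [^]\<^bsub>G\<^esub> r"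
      using ab by (simp add: conj[symmetric] m_assoc[symmetric])
    then have "(b \<otimes>\<^bsub>G\<^esub> a) \<otimes>\<^bsub>G\<^esub> b = b \<otimes>\<^bsub>G\<^esub> (b \<otimes>\<^bsub>G\<^esub> a [^]\<^bsub>G\<^esub> r)"
      using ab by (simp add: m_assoc)
    also have "\<dots> = (b \<otimes>\<^bsub>G\<^esub> b) \<otimes>\<^bsub>G\<^esub> a [^]\<^bsub>G\<^esub> r" using ab by (simp add: m_assoc)
    also have "\<dots> = a [^]\<^bsub>G\<^esub> r \<otimes>\<^bsub>G\<^esub> (b \<otimes>\<^bsub>G\<^esub> b)"
      using ab com by (metis group_commutes_pow m_closed)
    finally have ba: "b \<otimes>\<^bsub>G\<^esub> a = a [^]\<^bsub>G\<^esub> r \<otimes>\<^bsub>G\<^esub> b"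
      using ab by (simp add: m_assoc[symmetric])
    show ?thesis
    proof (intro maximal_class_presentation.intro maximal_class_presentation_axioms.intro)
      show "order G = 4 * 2 ^ (n - 2)" "a [^]\<^bsub>G\<^esub> (2 * 2 ^ (n - 2) :: nat) = \<one>\<^bsub>G\<^esub>"
        using G a by (simp_all add: j power_add)
    qed (use n ab gen b bb ba r G in auto)
  qed
  have inv: "inv\<^bsub>G\<^esub> a = a [^]\<^bsub>G\<^esub> (2 * 2 ^ (n - 2) - 1 :: nat)"
    if G: "group G" and a: "a \<in> carrier G" "a [^]\<^bsub>G\<^esub> (2 ^ (n - 1) :: nat) = \<one>\<^bsub>G\<^esub>" and n: "n \<ge> 3" for a n
  proof -
    interpret group G by fact
    obtain j where j: "n = 3 + j" using le_Suc_ex[OF n] by blast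
    let ?q = "2 * 2 ^ (n - 2) - 1 :: nat"
    have "a [^]\<^bsub>G\<^esub> ?q \<otimes>\<^bsub>G\<^esub> a = a [^]\<^bsub>G\<^esub> Suc ?q"
      by (rule nat_pow_Suc[symmetric])
    also have "Suc ?q = 2 ^ (n - 1)" by (simp add: j)
    finally show ?thesis using a by (intro inv_equality) auto
  qed
  have int: "a [^]\<^bsub>G\<^esub> (- 1 + 2 ^ (n - 2) :: int) = a [^]\<^bsub>G\<^esub> (2 ^ (n - 2) - 1 :: nat)"
    if "group G" for a n
  proof -
    have "(- 1 + 2 ^ (n - 2) :: int) = int (2 ^ (n - 2) - 1)" by (simp add: of_nat_diff)
    then show ?thesis by (simp only: int_pow_int)
  qed
  consider n where "n \<ge> 3" "dihedral_2_group n G"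
    | n where "n \<ge> 3" "generalized_quaternion_2_group n G"
    | n where "n \<ge> 4" "semidihedral_2_group n G"
    using assms unfolding maximal_class_2_group_def by blast
  then show thesis
  proof cases
    case (1 n)
    from 1(2) obtain a b where ab: "group G" "order G = 2 ^ n" "a \<in> carrier G" "b \<in> carrier G"
      "generate G {a, b} = carrier G" "a [^]\<^bsub>G\<^esub> (2 ^ (n - 1) :: nat) = \<one>\<^bsub>G\<^esub>"
      "b [^]\<^bsub>G\<^esub> (2 :: nat) = \<one>\<^bsub>G\<^esub>" "inv\<^bsub>G\<^esub> b \<otimes>\<^bsub>G\<^esub> a \<otimes>\<^bsub>G\<^esub> b = inv\<^bsub>G\<^esub> a"
      unfolding dihedral_2_group_def by blast
    show ?thesis
      using ab inv[OF ab(1,3,6) 1(1)]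
      by (intro that[OF *[OF ab(1,2) 1(1) ab(3-6) disjI1[OF ab(7)] _ disjI1[OF refl]]]) simp
  next
    case (2 n)
    from 2(2) obtain a b where ab: "group G" "order G = 2 ^ n" "a \<in> carrier G" "b \<in> carrier G"
      "generate G {a, b} = carrier G" "a [^]\<^bsub>G\<^esub> (2 ^ (n - 1) :: nat) = \<one>\<^bsub>G\<^esub>"
      "b [^]\<^bsub>G\<^esub> (2 :: nat) = a [^]\<^bsub>G\<^esub> (2 ^ (n - 2) :: nat)"
      "inv\<^bsub>G\<^esub> b \<otimes>\<^bsub>G\<^esub> a \<otimes>\<^bsub>G\<^esub> b = inv\<^bsub>G\<^esub> a"
      unfolding generalized_quaternion_2_group_def by blast
    show ?thesis
      using ab inv[OF ab(1,3,6) 2(1)]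
      by (intro that[OF *[OF ab(1,2) 2(1) ab(3-6) disjI2[OF conjI[OF ab(7) refl]] _ disjI1[OF refl]]]) simp
  next
    case (3 n)
    then have n: "n \<ge> 3" "n - 2 \<ge> 2" by auto
    from 3(2) obtain a b where ab: "group G" "order G = 2 ^ n" "a \<in> carrier G" "b \<in> carrier G"
      "generate G {a, b} = carrier G" "a [^]\<^bsub>G\<^esub> (2 ^ (n - 1) :: nat) = \<one>\<^bsub>G\<^esub>"
      "b [^]\<^bsub>G\<^esub> (2 :: nat) = \<one>\<^bsub>G\<^esub>"
      "inv\<^bsub>G\<^esub> b \<otimes>\<^bsub>G\<^esub> a \<otimes>\<^bsub>G\<^esub> b = a [^]\<^bsub>G\<^esub> (- 1 + 2 ^ (n - 2) :: int)"
      unfolding semidihedral_2_group_def by blast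
    show ?thesis
      using ab(8) unfolding int[OF ab(1)]
      by (rule that[OF *[OF ab(1,2) n(1) ab(3-6) disjI1[OF ab(7)] _ disjI2[OF conjI[OF refl n(2)]]]])
  qed
qed

lemma char2_ring_group_algebra:
  assumes "finite_group_algebra K G" "ring_characteristic K = 2"
  shows "char2_ring (group_algebra K G)"
proof -
  interpret finite_group_algebra K G by fact
  have ex: "\<exists>m::nat. m > 0 \<and> add_pow K m \<one>\<^bsub>K\<^esub> = \<zero>\<^bsub>K\<^esub>"
    using assms(2) unfolding ring_characteristic_def by (metis zero_neq_numeral)
  from LeastI_ex[OF ex] have "add_pow K (2::nat) \<one>\<^bsub>K\<^esub> = \<zero>\<^bsub>K\<^esub>"
    using assms(2) ex unfolding ring_characteristic_def by (simp split: if_splits)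
  then have "\<one>\<^bsub>K\<^esub> \<oplus>\<^bsub>K\<^esub> \<one>\<^bsub>K\<^esub> = \<zero>\<^bsub>K\<^esub>"
    by (simp add: numeral_2_eq_2)
  then have "\<one>\<^bsub>KG\<^esub> \<oplus>\<^bsub>KG\<^esub> \<one>\<^bsub>KG\<^esub> = \<zero>\<^bsub>KG\<^esub>"
    by (auto simp: KG_add KG_one KG_zero intro!: restrict_ext)
  then show ?thesis
    using ring_KG by (simp add: char2_ring_def char2_ring_axioms_def)
qed

lemma group_normalized_units:
  assumes "finite_group_algebra K G"
  shows "group (normalized_units K G)"
proof -
  interpret finite_group_algebra K G by fact
  interpret R: ring KG by (rule ring_KG)
  interpret U: group "units_of KG" by (rule R.units_group)
  interpret \<epsilon>: ring_hom_ring KG K "augmentation K G"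
    using ring_KG K.ring_axioms augmentation_hom by (rule ring_hom_ringI2)
  have "subgroup {u \<in> Units KG. augmentation K G u = \<one>\<^bsub>K\<^esub>} (units_of KG)"
  proof (rule U.subgroupI)
    fix u assume u: "u \<in> {u \<in> Units KG. augmentation K G u = \<one>\<^bsub>K\<^esub>}"
    then have "augmentation K G (inv\<^bsub>KG\<^esub> u) = augmentation K G (inv\<^bsub>KG\<^esub> u) \<otimes>\<^bsub>K\<^esub> augmentation K G u"
      by (simp add: R.Units_closed)
    also have "\<dots> = \<one>\<^bsub>K\<^esub>"
      using u by (subst \<epsilon>.hom_mult[symmetric]) (auto simp: R.Units_closed)
    finally show "inv\<^bsub>units_of KG\<^esub> u \<in> {u \<in> Units KG. augmentation K G u = \<one>\<^bsub>K\<^esub>}"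
      using u by (simp add: R.units_of_inv)
  next
    fix u u' assume "u \<in> {u \<in> Units KG. augmentation K G u = \<one>\<^bsub>K\<^esub>}"
      "u' \<in> {u \<in> Units KG. augmentation K G u = \<one>\<^bsub>K\<^esub>}"
    then show "u \<otimes>\<^bsub>units_of KG\<^esub> u' \<in> {u \<in> Units KG. augmentation K G u = \<one>\<^bsub>K\<^esub>}"
      by (simp add: units_of_mult R.Units_closed)
  qed (auto simp: units_of_carrier)
  then show ?thesis
    unfolding normalized_units_def by (rule U.subgroup_imp_group)
qed

locale modular_group_algebra =
  maximal_class_presentation G a b k r + finite_group_algebra K G
  for K :: "('k, 'm) ring_scheme" and G :: "('g, 'n) monoid_scheme" (structure) and a b k r +
  assumes characteristic: "ring_characteristic K = 2"
begin

sublocale R: char2_ring KG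
  using finite_group_algebra_axioms characteristic by (rule char2_ring_group_algebra)

section \<open>The element \<open>s\<close> and its highest nonzero power\<close>

definition s where "s = basis a \<oplus>\<^bsub>KG\<^esub> basis (a [^] r)"
definition \<sigma> where "\<sigma> = s [^]\<^bsub>KG\<^esub> (2 ^ k - 1 :: nat)"

lemma s_closed [simp]: "s \<in> carrier KG" by (simp add: s_def)
lemma \<sigma>_closed [simp]: "\<sigma> \<in> carrier KG" by (simp add: \<sigma>_def)

lemma a_commute: "a \<otimes> a [^] (n::nat) = a [^] n \<otimes> a"
  using nat_pow_Suc2[of a n] by simp

lemma basis_pow: "g \<in> carrier G \<Longrightarrow> basis g [^]\<^bsub>KG\<^esub> (n::nat) = basis (g [^] n)"
  by (induction n) (simp_all add: KG_one_basis basis_mult)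

lemma KG_add_coeff: "x \<in> carrier G \<Longrightarrow> (f \<oplus>\<^bsub>KG\<^esub> g) x = f x \<oplus>\<^bsub>K\<^esub> g x"
  by (simp add: KG_add)

lemma KG_finsum_coeff:
  assumes "finite S" "\<And>i. i \<in> S \<Longrightarrow> f i \<in> carrier KG" "x \<in> carrier G"
  shows "(\<Oplus>\<^bsub>KG\<^esub>i\<in>S. f i) x = (\<Oplus>\<^bsub>K\<^esub>i\<in>S. f i x)"
  using assms(1,2)
proof (induction S)
  case empty
  then show ?case using assms(3) by (simp add: KG_zero)
next
  case (insert i S)
  then show ?case using assms(3) by (simp add: KG_add_coeff Pi_def)
qed

text \<open>Frobenius turns \<open>s^m\<close> into \<open>a^m + a^(r m)\<close>, and
  \<open>r m\<close> is congruent to \<open>m\<close> modulo \<open>2 m\<close>.\<close>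

lemma s_nilpotent: "s [^]\<^bsub>KG\<^esub> (2 ^ k :: nat) = \<zero>\<^bsub>KG\<^esub>"
proof -
  have "basis a \<otimes>\<^bsub>KG\<^esub> basis (a [^] r) = basis (a [^] r) \<otimes>\<^bsub>KG\<^esub> basis a"
    by (simp add: basis_mult a_commute)
  then have "s [^]\<^bsub>KG\<^esub> (2 ^ k :: nat) =
      basis (a [^] m) \<oplus>\<^bsub>KG\<^esub> basis ((a [^] r) [^] m)"
    by (simp add: s_def R.frobenius_add basis_pow m_def)
  also have "(a [^] r) [^] m = a [^] m"
    using a_pow_cong[OF rm] by (simp add: nat_pow_pow)
  finally show ?thesis by simp
qed

text \<open>Write \<open>s = a (1 + u)\<close> with \<open>u = a^(r-1)\<close>. Then
  \<open>s^(m-1)\<close> is \<open>a^(m-1)\<close> times the sum of the first \<open>m\<close>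
  powers of \<open>u\<close>, that is, of all elements of \<open>T\<close>; as \<open>m - 1\<close>
  is odd, this shifts the even powers of \<open>a\<close> to the odd ones.\<close>

lemma \<sigma>_coeff: "\<sigma> (elt i j) = (if odd i \<and> \<not> j then \<one>\<^bsub>K\<^esub> else \<zero>\<^bsub>K\<^esub>)"
proof -
  let ?u = "basis (a [^] (r - 1))"
  define \<tau> where "\<tau> = (\<Oplus>\<^bsub>KG\<^esub>j\<in>{..<m}. basis (a [^] ((r - 1) * j :: nat)))"
  have [simp]: "\<tau> \<in> carrier KG" by (simp add: \<tau>_def)
  have r_Suc: "r = Suc (r - 1)" using odd_pos[OF r_odd] by simp
  have s: "s = basis a \<otimes>\<^bsub>KG\<^esub> (\<one>\<^bsub>KG\<^esub> \<oplus>\<^bsub>KG\<^esub> ?u)"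
    using r_Suc nat_pow_Suc2[of a "r - 1"] by (simp add: s_def R.r_distr basis_mult)
  have "basis a \<otimes>\<^bsub>KG\<^esub> ?u = ?u \<otimes>\<^bsub>KG\<^esub> basis a"
    by (simp add: basis_mult a_commute)
  then have "\<sigma> = basis a [^]\<^bsub>KG\<^esub> (m - 1) \<otimes>\<^bsub>KG\<^esub> (\<one>\<^bsub>KG\<^esub> \<oplus>\<^bsub>KG\<^esub> ?u) [^]\<^bsub>KG\<^esub> (m - 1)"
    unfolding \<sigma>_def s m_def by (intro R.pow_mult_distrib) (simp_all add: R.l_distr R.r_distr)
  also have "(\<one>\<^bsub>KG\<^esub> \<oplus>\<^bsub>KG\<^esub> ?u) [^]\<^bsub>KG\<^esub> (m - 1) = \<tau>"
    unfolding \<tau>_def m_def by (simp only: R.one_plus_pow_pred basis_closed) (simp add: basis_pow nat_pow_pow)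
  finally have \<sigma>: "\<sigma> = basis (a [^] (m - 1)) \<otimes>\<^bsub>KG\<^esub> \<tau>" by (simp add: basis_pow)
  have \<tau>: "\<tau> x = (if x \<in> T then \<one>\<^bsub>K\<^esub> else \<zero>\<^bsub>K\<^esub>)" if x: "x \<in> carrier G" for x
  proof -
    have "\<tau> x = (\<Oplus>\<^bsub>K\<^esub>j\<in>{..<m}. basis (a [^] ((r - 1) * j :: nat)) x)"
      unfolding \<tau>_def using x by (intro KG_finsum_coeff) auto
    also have "\<dots> = (\<Oplus>\<^bsub>K\<^esub>y\<in>(\<lambda>j. a [^] ((r - 1) * j :: nat)) ` {..<m}. basis y x)"
      using bij_betw_imp_inj_on[OF bij_betw_T'] x by (intro K.finsum_reindex[symmetric]) auto
    also have "\<dots> = (\<Oplus>\<^bsub>K\<^esub>y\<in>T. if x = y then \<one>\<^bsub>K\<^esub> else \<zero>\<^bsub>K\<^esub>)"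
      unfolding bij_betw_imp_surj_on[OF bij_betw_T'] using x
      by (intro K.finsum_cong') (auto simp: basis_def)
    also have "\<dots> = (if x \<in> T then \<one>\<^bsub>K\<^esub> else \<zero>\<^bsub>K\<^esub>)"
    proof (cases "x \<in> T")
      case True
      then show ?thesis
        using K.finsum_singleton[of x T "\<lambda>_. \<one>\<^bsub>K\<^esub>"] finite_subset[OF T_subset finite_carrier] by auto
    next
      case False
      then have "(\<Oplus>\<^bsub>K\<^esub>y\<in>T. if x = y then \<one>\<^bsub>K\<^esub> else \<zero>\<^bsub>K\<^esub>) = (\<Oplus>\<^bsub>K\<^esub>y\<in>T. \<zero>\<^bsub>K\<^esub>)"
        by (intro K.finsum_cong') auto
      then show ?thesis using False by simp
    qed
    finally show ?thesis .
  qed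
  have "inv (a [^] (m - 1)) \<otimes> elt i j = elt ((2 * m - 1) * (m - 1) + i) j"
    by (simp add: elt_def inv_a_pow nat_pow_mult flip: m_assoc)
  moreover have "odd ((2 * m - 1) * (m - 1))" using m_ge_2 m_even by simp
  ultimately show ?thesis
    by (simp add: \<sigma> basis_mult_left \<tau> T_iff)
qed

text \<open>
  The nonvanishing condition is read off from the coefficients at \<open>a b\<close>: they are \<open>1\<close> for \<open>\<sigma> c\<close> and
  \<open>0\<close> for the four excluded elements.
\<close>

lemma wreath_section_exists: "\<exists>c t w. wreath_section KG c t s w k"
proof -
  let ?A = "basis a" and ?B = "basis b" and ?d = "basis (a [^] r)"
  have comm: "?A \<otimes>\<^bsub>KG\<^esub> ?d = ?d \<otimes>\<^bsub>KG\<^esub> ?A" "?B \<otimes>\<^bsub>KG\<^esub> ?A = ?d \<otimes>\<^bsub>KG\<^esub> ?B"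
    "?B \<otimes>\<^bsub>KG\<^esub> ?d = ?A \<otimes>\<^bsub>KG\<^esub> ?B"
    using ba b_a_pow[of r] a_pow_cong[OF rr]
    by (simp_all add: basis_mult a_commute)
  have \<sigma>s: "\<sigma> \<otimes>\<^bsub>KG\<^esub> s = \<zero>\<^bsub>KG\<^esub>" and s\<sigma>: "s \<otimes>\<^bsub>KG\<^esub> \<sigma> = \<zero>\<^bsub>KG\<^esub>"
  proof -
    have "Suc (2 ^ k - 1) = 2 ^ k" by simp
    then show "\<sigma> \<otimes>\<^bsub>KG\<^esub> s = \<zero>\<^bsub>KG\<^esub>" "s \<otimes>\<^bsub>KG\<^esub> \<sigma> = \<zero>\<^bsub>KG\<^esub>"
      using s_nilpotent R.nat_pow_Suc[of s "2 ^ k - 1"] R.nat_pow_Suc2[of s "2 ^ k - 1"]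
      unfolding \<sigma>_def by (metis s_closed)+
  qed
  have As: "?A \<otimes>\<^bsub>KG\<^esub> s = s \<otimes>\<^bsub>KG\<^esub> ?A" and Bs: "?B \<otimes>\<^bsub>KG\<^esub> s = s \<otimes>\<^bsub>KG\<^esub> ?B"
    and ds: "?d \<otimes>\<^bsub>KG\<^esub> s = s \<otimes>\<^bsub>KG\<^esub> ?d"
    by (simp_all add: s_def R.l_distr R.r_distr comm R.a_ac)
  then have A\<sigma>: "?A \<otimes>\<^bsub>KG\<^esub> \<sigma> = \<sigma> \<otimes>\<^bsub>KG\<^esub> ?A" and d\<sigma>: "?d \<otimes>\<^bsub>KG\<^esub> \<sigma> = \<sigma> \<otimes>\<^bsub>KG\<^esub> ?d"
    unfolding \<sigma>_def by (metis R.group_commutes_pow basis_closed s_closed)+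
  \<comment> \<open>For \<open>b^2 = 1\<close>, the dihedral and semidihedral cases,
    \<open>\<theta> = 1\<close> makes \<open>c^2\<close> vanish. Otherwise \<open>d\<close> is the
    inverse of \<open>a\<close>, and the approximate root of \<open>a^m\<close> is used.\<close>
  obtain \<theta> where \<theta>: "\<theta> \<in> carrier KG" "?A \<otimes>\<^bsub>KG\<^esub> \<theta> = \<theta> \<otimes>\<^bsub>KG\<^esub> ?A" "?d \<otimes>\<^bsub>KG\<^esub> \<theta> = \<theta> \<otimes>\<^bsub>KG\<^esub> ?d"
      "?B \<otimes>\<^bsub>KG\<^esub> \<theta> = \<theta> \<otimes>\<^bsub>KG\<^esub> ?B" "\<sigma> \<otimes>\<^bsub>KG\<^esub> \<theta> = \<sigma>"
    and w: "\<one>\<^bsub>KG\<^esub> \<oplus>\<^bsub>KG\<^esub> \<theta> \<otimes>\<^bsub>KG\<^esub> \<theta> \<otimes>\<^bsub>KG\<^esub> (?B \<otimes>\<^bsub>KG\<^esub> ?B) = \<zero>\<^bsub>KG\<^esub> \<or>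
      \<one>\<^bsub>KG\<^esub> \<oplus>\<^bsub>KG\<^esub> \<theta> \<otimes>\<^bsub>KG\<^esub> \<theta> \<otimes>\<^bsub>KG\<^esub> (?B \<otimes>\<^bsub>KG\<^esub> ?B) = \<sigma> \<otimes>\<^bsub>KG\<^esub> basis (a [^] (m + 1)) \<and>
        ?d \<otimes>\<^bsub>KG\<^esub> ?A = \<one>\<^bsub>KG\<^esub>"
  proof (cases "b \<otimes> b = \<one>")
    case True
    then show ?thesis
      by (intro that[of "\<one>\<^bsub>KG\<^esub>"]) (simp_all add: basis_mult flip: KG_one_basis)
  next
    case False
    then have bb: "b \<otimes> b = a [^] m" and r: "r = 2 * m - 1" using b_square by (auto simp: m_def)
    have "Suc r = 2 * m" using r m_ge_2 by simp
    then have "a [^] Suc r = \<one>" using a_pow by (simp add: m_def)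
    then have dA: "?d \<otimes>\<^bsub>KG\<^esub> ?A = \<one>\<^bsub>KG\<^esub>" by (simp add: basis_mult KG_one_basis)
    then have Ad: "?A \<otimes>\<^bsub>KG\<^esub> ?d = \<one>\<^bsub>KG\<^esub>" by (simp add: comm)
    obtain j where j: "k = Suc j" using k by (cases k) auto
    obtain \<theta> where \<theta>: "\<theta> \<in> carrier KG" "?A \<otimes>\<^bsub>KG\<^esub> \<theta> = \<theta> \<otimes>\<^bsub>KG\<^esub> ?A" "?d \<otimes>\<^bsub>KG\<^esub> \<theta> = \<theta> \<otimes>\<^bsub>KG\<^esub> ?d"
      "?B \<otimes>\<^bsub>KG\<^esub> \<theta> = \<theta> \<otimes>\<^bsub>KG\<^esub> ?B" "\<sigma> \<otimes>\<^bsub>KG\<^esub> \<theta> = \<sigma>"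
      and "?A [^]\<^bsub>KG\<^esub> (2 ^ k :: nat) = \<theta> \<otimes>\<^bsub>KG\<^esub> \<theta> \<oplus>\<^bsub>KG\<^esub> \<sigma> \<otimes>\<^bsub>KG\<^esub> ?A"
      using R.two_power_root_expansion[of ?A ?B ?d \<sigma> j, folded s_def j, folded \<sigma>_def,
          OF basis_closed basis_closed basis_closed \<sigma>_closed Ad dA comm(2,3) \<sigma>s]
      by blast
    \<comment> \<open>Multiplying by \<open>b^2 = a^m\<close>, with \<open>a^(2m) = 1\<close>, will
      give \<open>1 + \<sigma> a^(m+1)\<close>, so that \<open>w\<close> is
      \<open>\<sigma> a^(m+1)\<close>.\<close>
    then have "\<theta> \<otimes>\<^bsub>KG\<^esub> \<theta> = basis (a [^] m) \<oplus>\<^bsub>KG\<^esub> \<sigma> \<otimes>\<^bsub>KG\<^esub> ?A"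
      by (simp add: basis_pow m_def R.a_ac)
    then have "\<theta> \<otimes>\<^bsub>KG\<^esub> \<theta> \<otimes>\<^bsub>KG\<^esub> (?B \<otimes>\<^bsub>KG\<^esub> ?B) =
        basis (a [^] m \<otimes> a [^] m) \<oplus>\<^bsub>KG\<^esub> \<sigma> \<otimes>\<^bsub>KG\<^esub> basis (a \<otimes> a [^] m)"
      by (simp add: basis_mult bb R.l_distr R.m_assoc)
    also have "a [^] m \<otimes> a [^] m = \<one>" using a_pow by (simp add: m_def nat_pow_mult mult_2)
    also have "a \<otimes> a [^] m = a [^] (m + 1)" using nat_pow_Suc2[of a m] by simp
    finally show ?thesis
      using \<theta> dA by (intro that[of \<theta>]) (simp_all flip: KG_one_basis)
  qed
  define w where "w = \<one>\<^bsub>KG\<^esub> \<oplus>\<^bsub>KG\<^esub> \<theta> \<otimes>\<^bsub>KG\<^esub> \<theta> \<otimes>\<^bsub>KG\<^esub> (?B \<otimes>\<^bsub>KG\<^esub> ?B)"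
  define c where "c = \<one>\<^bsub>KG\<^esub> \<oplus>\<^bsub>KG\<^esub> \<theta> \<otimes>\<^bsub>KG\<^esub> ?B"
  let ?g = "a [^] (m + 1)"
  have Ag: "?A \<otimes>\<^bsub>KG\<^esub> basis ?g = basis ?g \<otimes>\<^bsub>KG\<^esub> ?A"
    by (simp only: basis_mult a_commute a nat_pow_closed)
  have gs: "basis ?g \<otimes>\<^bsub>KG\<^esub> s = s \<otimes>\<^bsub>KG\<^esub> basis ?g"
  proof -
    have "?A [^]\<^bsub>KG\<^esub> (m + 1) \<otimes>\<^bsub>KG\<^esub> s = s \<otimes>\<^bsub>KG\<^esub> ?A [^]\<^bsub>KG\<^esub> (m + 1)"
      using As by (metis R.group_commutes_pow basis_closed s_closed)
    then show ?thesis by (simp only: basis_pow a)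
  qed
  then have g\<sigma>: "basis ?g \<otimes>\<^bsub>KG\<^esub> \<sigma> = \<sigma> \<otimes>\<^bsub>KG\<^esub> basis ?g"
    unfolding \<sigma>_def by (metis R.group_commutes_pow basis_closed s_closed)
  have \<sigma>\<sigma>: "\<sigma> \<otimes>\<^bsub>KG\<^esub> \<sigma> = \<zero>\<^bsub>KG\<^esub>"
  proof -
    \<comment> \<open>The exponent \<open>2^k - 1\<close> is positive because \<open>k > 0\<close>,
      so a second factor \<open>\<sigma>\<close> contains the \<open>s\<close> that kills the
      first.\<close>
    obtain i where i: "(2 ^ k - 1 :: nat) = Suc i" using m_ge_2 unfolding m_def by (cases "2 ^ k - 1 :: nat") auto
    have "\<sigma> \<otimes>\<^bsub>KG\<^esub> s [^]\<^bsub>KG\<^esub> Suc i = (\<sigma> \<otimes>\<^bsub>KG\<^esub> s) \<otimes>\<^bsub>KG\<^esub> s [^]\<^bsub>KG\<^esub> i"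
      by (simp only: R.nat_pow_Suc2 R.m_assoc \<sigma>_closed s_closed R.nat_pow_closed)
    also have "\<dots> = \<zero>\<^bsub>KG\<^esub>" by (simp add: \<sigma>s)
    also have "s [^]\<^bsub>KG\<^esub> Suc i = \<sigma>" by (simp only: \<sigma>_def i)
    finally show ?thesis .
  qed
  have w: "w = \<zero>\<^bsub>KG\<^esub> \<or> w = \<sigma> \<otimes>\<^bsub>KG\<^esub> basis ?g \<and> ?d \<otimes>\<^bsub>KG\<^esub> ?A = \<one>\<^bsub>KG\<^esub>"
    using w by (simp add: w_def)
  have w_facts: "s \<otimes>\<^bsub>KG\<^esub> w = \<zero>\<^bsub>KG\<^esub>" "?A \<otimes>\<^bsub>KG\<^esub> w = w \<otimes>\<^bsub>KG\<^esub> ?A"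
    "w \<otimes>\<^bsub>KG\<^esub> (?d \<otimes>\<^bsub>KG\<^esub> ?A) = w" "w \<otimes>\<^bsub>KG\<^esub> w = \<zero>\<^bsub>KG\<^esub>"
  proof -
    have "s \<otimes>\<^bsub>KG\<^esub> (\<sigma> \<otimes>\<^bsub>KG\<^esub> basis ?g) = \<zero>\<^bsub>KG\<^esub>"
      by (simp add: s\<sigma> flip: R.m_assoc)
    moreover have "?A \<otimes>\<^bsub>KG\<^esub> (\<sigma> \<otimes>\<^bsub>KG\<^esub> basis ?g) = \<sigma> \<otimes>\<^bsub>KG\<^esub> basis ?g \<otimes>\<^bsub>KG\<^esub> ?A"
    proof -
      have "?A \<otimes>\<^bsub>KG\<^esub> (\<sigma> \<otimes>\<^bsub>KG\<^esub> basis ?g) = \<sigma> \<otimes>\<^bsub>KG\<^esub> (?A \<otimes>\<^bsub>KG\<^esub> basis ?g)"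
        by (simp only: A\<sigma> R.m_assoc[symmetric] basis_closed \<sigma>_closed)
      then show ?thesis by (simp only: Ag R.m_assoc basis_closed \<sigma>_closed)
    qed
    moreover have "\<sigma> \<otimes>\<^bsub>KG\<^esub> basis ?g \<otimes>\<^bsub>KG\<^esub> (\<sigma> \<otimes>\<^bsub>KG\<^esub> basis ?g) = \<zero>\<^bsub>KG\<^esub>"
    proof -
      have "\<sigma> \<otimes>\<^bsub>KG\<^esub> basis ?g \<otimes>\<^bsub>KG\<^esub> (\<sigma> \<otimes>\<^bsub>KG\<^esub> basis ?g) =
          \<sigma> \<otimes>\<^bsub>KG\<^esub> (basis ?g \<otimes>\<^bsub>KG\<^esub> \<sigma>) \<otimes>\<^bsub>KG\<^esub> basis ?g"
        by (simp only: R.m_assoc basis_closed \<sigma>_closed R.m_closed)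
      also have "\<dots> = (\<sigma> \<otimes>\<^bsub>KG\<^esub> \<sigma>) \<otimes>\<^bsub>KG\<^esub> basis ?g \<otimes>\<^bsub>KG\<^esub> basis ?g"
        by (simp only: g\<sigma> R.m_assoc basis_closed \<sigma>_closed R.m_closed)
      finally show ?thesis by (simp add: \<sigma>\<sigma>)
    qed
    ultimately show "s \<otimes>\<^bsub>KG\<^esub> w = \<zero>\<^bsub>KG\<^esub>" "?A \<otimes>\<^bsub>KG\<^esub> w = w \<otimes>\<^bsub>KG\<^esub> ?A"
      "w \<otimes>\<^bsub>KG\<^esub> (?d \<otimes>\<^bsub>KG\<^esub> ?A) = w" "w \<otimes>\<^bsub>KG\<^esub> w = \<zero>\<^bsub>KG\<^esub>"
      using w by auto
  qed
  let ?x = "a \<otimes> b"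
  have shift: "inv (a [^] l) \<otimes> ?x = elt ((2 * m - 1) * l + 1) True" for l :: nat
  proof -
    have "inv (a [^] l) \<otimes> ?x = a [^] ((2 * m - 1) * l) \<otimes> a \<otimes> b"
      by (simp only: inv_a_pow m_assoc a b nat_pow_closed)
    then show ?thesis by (simp add: elt_def)
  qed
  \<comment> \<open>\<open>\<sigma> \<theta> = \<sigma>\<close> reduces the product to
    \<open>\<sigma> + \<sigma> b\<close>, whose coefficient at \<open>a b\<close> is that of
    \<open>\<sigma>\<close> at the odd power \<open>a\<close>.\<close>
  have \<sigma>c: "(\<sigma> \<otimes>\<^bsub>KG\<^esub> c) ?x = \<one>\<^bsub>K\<^esub>"
  proof -
    have "\<sigma> \<otimes>\<^bsub>KG\<^esub> c = \<sigma> \<oplus>\<^bsub>KG\<^esub> \<sigma> \<otimes>\<^bsub>KG\<^esub> ?B"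
      using \<theta> by (simp add: c_def R.r_distr flip: R.m_assoc)
    moreover have "\<sigma> ?x = \<zero>\<^bsub>K\<^esub>" using \<sigma>_coeff[of 1 True] by (simp add: elt_def)
    moreover have "(\<sigma> \<otimes>\<^bsub>KG\<^esub> ?B) ?x = \<one>\<^bsub>K\<^esub>"
      using \<sigma>_coeff[of 1 False] by (simp add: basis_mult_right m_assoc elt_def)
    ultimately show ?thesis by (simp add: KG_add_coeff)
  qed
  \<comment> \<open>The product is \<open>a \<sigma> + d \<sigma> b\<close>. The first summand lives
    on powers of \<open>a\<close>; the second lives on even powers of \<open>a\<close> times
    \<open>b\<close>, since \<open>d = a^r\<close> with \<open>r\<close> odd. Neither support
    contains \<open>a b\<close>.\<close>
  have \<sigma>t: "(\<sigma> \<otimes>\<^bsub>KG\<^esub> (c \<otimes>\<^bsub>KG\<^esub> ?A)) ?x = \<zero>\<^bsub>K\<^esub>"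
  proof -
    have "\<sigma> \<otimes>\<^bsub>KG\<^esub> (c \<otimes>\<^bsub>KG\<^esub> ?A) = \<sigma> \<otimes>\<^bsub>KG\<^esub> ?A \<oplus>\<^bsub>KG\<^esub> \<sigma> \<otimes>\<^bsub>KG\<^esub> (?B \<otimes>\<^bsub>KG\<^esub> ?A)"
      using \<theta> by (simp add: c_def R.l_distr R.r_distr R.m_assoc flip: R.m_assoc[of \<sigma> \<theta>])
    also have "\<dots> = ?A \<otimes>\<^bsub>KG\<^esub> \<sigma> \<oplus>\<^bsub>KG\<^esub> ?d \<otimes>\<^bsub>KG\<^esub> (\<sigma> \<otimes>\<^bsub>KG\<^esub> ?B)"
      by (simp add: comm A\<sigma> d\<sigma> flip: R.m_assoc)
    finally have eq: "\<sigma> \<otimes>\<^bsub>KG\<^esub> (c \<otimes>\<^bsub>KG\<^esub> ?A) = ?A \<otimes>\<^bsub>KG\<^esub> \<sigma> \<oplus>\<^bsub>KG\<^esub> ?d \<otimes>\<^bsub>KG\<^esub> (\<sigma> \<otimes>\<^bsub>KG\<^esub> ?B)" .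
    have "(?A \<otimes>\<^bsub>KG\<^esub> \<sigma>) ?x = \<zero>\<^bsub>K\<^esub>"
      using \<sigma>_coeff[of 0 True] by (simp add: basis_mult_left elt_def flip: m_assoc)
    moreover have "(?d \<otimes>\<^bsub>KG\<^esub> (\<sigma> \<otimes>\<^bsub>KG\<^esub> ?B)) ?x = \<zero>\<^bsub>K\<^esub>"
    proof -
      let ?l = "(2 * m - 1) * r + 1"
      have "(?d \<otimes>\<^bsub>KG\<^esub> (\<sigma> \<otimes>\<^bsub>KG\<^esub> ?B)) ?x = (\<sigma> \<otimes>\<^bsub>KG\<^esub> ?B) (elt ?l True)"
        by (simp add: basis_mult_left shift)
      also have "\<dots> = \<sigma> (elt ?l True \<otimes> inv b)" by (simp add: basis_mult_right)
      also have "elt ?l True \<otimes> inv b = elt ?l False" by (simp add: elt_def m_assoc)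
      also have "\<sigma> (elt ?l False) = \<zero>\<^bsub>K\<^esub>" using r_odd m_ge_2 by (simp add: \<sigma>_coeff)
      finally show ?thesis .
    qed
    ultimately show ?thesis by (simp add: eq KG_add_coeff)
  qed
  \<comment> \<open>If nonzero, \<open>w\<close> is \<open>\<sigma>\<close> times a power of
    \<open>a\<close>, hence supported on powers of \<open>a\<close>.\<close>
  have wx: "w ?x = \<zero>\<^bsub>K\<^esub>"
  proof -
    have "(\<sigma> \<otimes>\<^bsub>KG\<^esub> basis ?g) ?x = (basis ?g \<otimes>\<^bsub>KG\<^esub> \<sigma>) ?x" by (simp only: g\<sigma>)
    also have "\<dots> = \<sigma> (elt ((2 * m - 1) * (m + 1) + 1) True)"
      by (simp only: basis_mult_left shift \<sigma>_closed m_closed a b nat_pow_closed)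
    also have "\<dots> = \<zero>\<^bsub>K\<^esub>" by (simp only: \<sigma>_coeff) simp
    finally show ?thesis using w by (auto simp: KG_zero)
  qed
  have "\<sigma> \<otimes>\<^bsub>KG\<^esub> c \<noteq> f" if "f ?x = \<zero>\<^bsub>K\<^esub>" for f
    using \<sigma>c that by auto
  then have "\<sigma> \<otimes>\<^bsub>KG\<^esub> c \<notin> {\<zero>\<^bsub>KG\<^esub>, w, \<sigma> \<otimes>\<^bsub>KG\<^esub> (c \<otimes>\<^bsub>KG\<^esub> ?A), w \<oplus>\<^bsub>KG\<^esub> \<sigma> \<otimes>\<^bsub>KG\<^esub> (c \<otimes>\<^bsub>KG\<^esub> ?A)}"
    using wx \<sigma>t by (auto simp: KG_add_coeff KG_zero)
  then have "wreath_section KG c (c \<otimes>\<^bsub>KG\<^esub> ?A) s w k"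
    unfolding c_def w_def s_def
    using \<theta> comm k w_facts s_nilpotent
    by (intro R.wreath_section_intro) (simp_all add: c_def w_def s_def \<sigma>_def)
  then show ?thesis by blast
qed

lemma wreath_product_involved_in_normalized_units:
  "involved_in (regular_wreath_product (integer_mod_group 2) (G\<lparr>carrier := derived G (carrier G)\<rparr>))
     (normalized_units K G)"
proof -
  obtain c t w where "wreath_section KG c t s w k"
    using wreath_section_exists by blast
  then interpret W: wreath_section KG c t s w k .
  \<comment> \<open>The discrete logarithm to base \<open>a^2\<close>, an isomorphism from the
    commutator subgroup to the integers modulo \<open>m\<close>.\<close>
  define ix where "ix = the_inv_into {..<m} (\<lambda>i. a [^] (2 * i :: nat))"
  have ix: "bij_betw ix T {..<m}"
    unfolding ix_def using bij_betw_T by (rule bij_betw_the_inv_into)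
  have ix_pow: "ix (a [^] (2 * i)) = i mod m" for i :: nat
  proof -
    have "[2 * i = 2 * (i mod m)] (mod 2 * m)" unfolding cong_def mult_mod_right[symmetric] by simp
    then have "a [^] (2 * i) = a [^] (2 * (i mod m))" by (rule a_pow_cong)
    then show ?thesis
      unfolding ix_def using m_ge_2 bij_betw_imp_inj_on[OF bij_betw_T]
      by (simp only:) (rule the_inv_into_f_f, auto)
  qed
  show ?thesis
  proof (rule W.wreath_product_involved[where ix = ix and \<epsilon> = "augmentation K G" and K = K])
    show "group (G\<lparr>carrier := derived G (carrier G)\<rparr>)"
      by (simp add: derived_eq_T subgroup_T subgroup_imp_group)
    show "bij_betw ix (carrier (G\<lparr>carrier := derived G (carrier G)\<rparr>)) {..<2 ^ k}"
      using ix by (simp add: derived_eq_T m_def)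
    show "group (normalized_units K G)"
      using finite_group_algebra_axioms by (rule group_normalized_units)
    show "domain K" by (rule K.domain_axioms)
    show "augmentation K G \<in> ring_hom KG K" by (rule augmentation_hom)
  next
    fix x y assume "x \<in> carrier (G\<lparr>carrier := derived G (carrier G)\<rparr>)"
      "y \<in> carrier (G\<lparr>carrier := derived G (carrier G)\<rparr>)"
    then obtain i j :: nat where xy: "x = a [^] (2 * i)" "y = a [^] (2 * j)"
      by (auto simp: derived_eq_T T_def)
    then have "x \<otimes> y = a [^] (2 * (i + j))" by (simp add: nat_pow_mult)
    then have "ix (x \<otimes> y) = (i + j) mod m" by (simp only: ix_pow)
    moreover have "ix x = i mod m" "ix y = j mod m" using xy by (simp_all only: ix_pow)
    ultimately show "ix (x \<otimes>\<^bsub>G\<lparr>carrier := derived G (carrier G)\<rparr>\<^esub> y) = (ix x + ix y) mod 2 ^ k"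
      by (simp add: m_def mod_add_eq)
  qed (simp_all add: normalized_units_def units_of_mult units_of_one)
qed

end

theorem theorem1:
  fixes K :: "('k, 'm) ring_scheme" and G :: "('g, 'n) monoid_scheme"
  assumes "field K"
    and "ring_characteristic K = 2"
    and "maximal_class_2_group G"
  shows "involved_in
           (regular_wreath_product (integer_mod_group 2) (G\<lparr>carrier := derived G (carrier G)\<rparr>))
           (normalized_units K G)"
proof -
  obtain a b k r where "maximal_class_presentation G a b k r"
    using maximal_class_2_group_presentation[OF assms(3)] by blast
  then interpret maximal_class_presentation G a b k r .
  interpret modular_group_algebra K G a b k r
    using assms finite_G is_group maximal_class_presentation_axioms
    by (simp add: modular_group_algebra_def finite_group_algebra_def finite_group_algebra_axioms_def
        modular_group_algebra_axioms_def)
  show ?thesis by (rule wreath_product_involved_in_normalized_units)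
qed

end
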